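(* Let $\mu$ be a measure on $\mathcal{B}(\varGamma)$. Let $T\in\mathcal{B}(\varGamma)$ be a transversal with respect to $\varLambda$ and let $h_\lambda$ be the Radon-Nikodym derivative of the corresponding measure $\nu_\lambda$ with respect to $\nu=\sum_{\lambda\in\varLambda}\nu_\lambda$. If $\varLambda$ consists of $n$ elements, $n\in\mathbb{N}$, then the spaces $C_2\mathbf{P}(\tilde x)$, $\tilde x\in\tilde G$, are pairwise orthogonal in $L^2(\mu)$ if and only if $h_\lambda=\frac1n$ $\nu$-a.e. for every $\lambda\in\varLambda$. If $\varLambda$ is countably infinite, then the spaces $C_2\mathbf{P}(\tilde x)$, $\tilde x\in\tilde G$, do not constitute a family of pairwise orthogonal subspaces of $L^2(\mu)$.
   Context: $G$ is an LCA group (locally compact abelian, Hausdorff, written additively), $H$ a closed subgroup of $G$, and $\tilde x=x+H\in\tilde G:=G/H$ for $x\in G$. $\varGamma$ is the dual group of $G$, $\langle\gamma,x\rangle$ is the value of $\gamma\in\varGamma$ at $x\in G$, and $\varLambda:=\{\gamma\in\varGamma:\langle\gamma,y\rangle=1\ \forall y\in H\}$ is the annihilator of $H$. Standing assumption: $\varLambda$ is finite or countably infinite. $\mathcal{B}(\varGamma)$ is the Borel $\sigma$-algebra of $\varGamma$. A "measure on $\mathcal{B}(\varGamma)$" means a finite non-negative regular measure: for all $B\in\mathcal{B}(\varGamma)$ and $\epsilon>0$ there are a compact $K$ and an open $U$ with $K\subset B\subset U$ and $\mu(U\setminus K)<\epsilon$. $L^2(\mu)$ is the Hilbert space of ($\mu$-classes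 of) square integrable Borel functions $\varGamma\to\mathbb{C}$, and $C_2\mathcal{L}$ is the closure of $\mathcal{L}\subset L^2(\mu)$ in it. For non-empty $S\subseteq G$, $\mathbf{P}(S)$ is the linear space of functions $p:\varGamma\to\mathbb{C}$ that are finite sums $p(\cdot)=\sum_k a_k\langle\cdot,s_k\rangle$ with $a_k\in\mathbb{C}$, $s_k\in S$; for $x\in G$ set $\mathbf{P}(\tilde x):=\mathbf{P}(x+H)$, which depends only on $\tilde x$. "Pairwise orthogonal" means that $C_2\mathbf{P}(\tilde x)\perp C_2\mathbf{P}(\tilde y)$ whenever $\tilde x\ne\tilde y$. A transversal (with respect to $\varLambda$) is a subset $T\subseteq\varGamma$ meeting each $\varLambda$-coset exactly once. Given $\mu$ and a transversal $T\in\mathcal{B}(\varGamma)$, define for $\lambda\in\varLambda$ and $B\in\mathcal{B}(\varGamma)$: $\mu_\lambda(B):=\mu(B\cap(T+\lambda))$, $\nu_\lambda(B):=\mu_\lambda(\lambda+B)$, and $\nu:=\sum_{\lambda\in\varLambda}\nu_\lambda$. The Radon-Nikodym derivative $h_\lambda$ is chosen to be a Borel function with values in $[0,\infty)$ and $h_\lambda=0$ on $\varGamma\setminus T$.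
   Formalization: In the countably infinite case the measure μ is assumed to be non-zero; for μ = 0 the space L²(μ) is {0}, all the spaces are trivially pairwise orthogonal, and the claim as worded fails. *)

theory Defs
  imports "HOL-Analysis.Analysis" "HOL-Library.Set_Algebras"
begin

section \<open>The dual group\<close>

typedef (overloaded) ('g :: topological_ab_group_add) dual =
  "{\<theta> :: 'g \<Rightarrow> complex. continuous_on UNIV \<theta> \<and> (\<forall>x. cmod (\<theta> x) = 1) \<and>
      (\<forall>x y. \<theta> (x + y) = \<theta> x * \<theta> y)}"
  morphisms pairing Abs_dual
  by (rule exI[of _ "\<lambda>_. 1"]) auto

notation pairing (\<open>\<langle>_,/ _\<rangle>\<close>)

lemma continuous_pairing: "continuous_on UNIV (pairing \<gamma>)"
  and norm_pairing [simp]: "cmod \<langle>\<gamma>, x\<rangle> = 1"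
  and pairing_add_right: "\<langle>\<gamma>, x + y\<rangle> = \<langle>\<gamma>, x\<rangle> * \<langle>\<gamma>, y\<rangle>"
  using pairing[of \<gamma>] by auto

lemma pairing_nonzero [simp]: "\<langle>\<gamma>, x\<rangle> \<noteq> 0"
  using norm_pairing[of \<gamma> x] by fastforce

lemma dual_eqI: "(\<And>x. \<langle>\<gamma>, x\<rangle> = \<langle>\<theta>, x\<rangle>) \<Longrightarrow> \<gamma> = \<theta>"
  by (metis ext pairing_inject)

instantiation dual :: (topological_ab_group_add) ab_group_add
begin

definition zero_dual :: "'a dual" where "0 = Abs_dual (\<lambda>_. 1)"

definition plus_dual :: "'a dual \<Rightarrow> 'a dual \<Rightarrow> 'a dual" where
  "\<gamma> + \<theta> = Abs_dual (\<lambda>x. \<langle>\<gamma>, x\<rangle> * \<langle>\<theta>, x\<rangle>)"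

definition uminus_dual :: "'a dual \<Rightarrow> 'a dual" where
  "- \<gamma> = Abs_dual (\<lambda>x. cnj \<langle>\<gamma>, x\<rangle>)"

definition minus_dual :: "'a dual \<Rightarrow> 'a dual \<Rightarrow> 'a dual" where
  "\<gamma> - \<theta> = \<gamma> + - (\<theta> :: 'a dual)"

lemma pairing_zero_left [simp]: "\<langle>0 :: 'a dual, x\<rangle> = 1"
  unfolding zero_dual_def by (subst Abs_dual_inverse) auto

lemma pairing_add_left: "\<langle>\<gamma> + \<theta>, x\<rangle> = \<langle>\<gamma>, x\<rangle> * \<langle>\<theta> :: 'a dual, x\<rangle>"
  unfolding plus_dual_def
  by (subst Abs_dual_inverse)
    (auto simp: norm_mult pairing_add_right intro!: continuous_intros continuous_pairing)

lemma pairing_uminus_left: "\<langle>- \<gamma>, x\<rangle> = cnj \<langle>\<gamma> :: 'a dual, x\<rangle>"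
  unfolding uminus_dual_def
  by (subst Abs_dual_inverse)
    (auto simp: pairing_add_right intro!: continuous_intros continuous_pairing)

instance
proof
  fix a b c :: "'a dual"
  show "a + b + c = a + (b + c)" "a + b = b + a" "0 + a = a"
    by (rule dual_eqI; simp add: pairing_add_left)+
  show "- a + a = 0"
  proof (rule dual_eqI)
    fix x
    show "\<langle>- a + a, x\<rangle> = \<langle>0, x\<rangle>"
      using complex_norm_square[of "\<langle>a, x\<rangle>"]
      by (simp add: pairing_add_left pairing_uminus_left mult.commute)
  qed
  show "a - b = a + - b" by (rule minus_dual_def)
qed

end

text \<open>The topology of uniform convergence on compact sets: the sets
  \<open>{\<theta>. \<forall>x\<in>K. \<bar>\<langle>\<theta>, x\<rangle> - \<langle>\<gamma>, x\<rangle>\<bar> < \<epsilon>}\<close> with \<open>K\<close> compact and \<open>\<epsilon> > 0\<close> are a neighbourhood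
  base at \<open>\<gamma>\<close>.\<close>

instantiation dual :: (topological_ab_group_add) topological_space
begin

definition open_dual :: "'a dual set \<Rightarrow> bool" where
  "open S \<longleftrightarrow> (\<forall>\<gamma>\<in>S. \<exists>K \<epsilon>. compact K \<and> 0 < \<epsilon> \<and>
     {\<theta>. \<forall>x\<in>K. dist \<langle>\<theta>, x\<rangle> \<langle>\<gamma>, x\<rangle> < \<epsilon>} \<subseteq> (S :: 'a dual set))"

instance
proof
  show "open (UNIV :: 'a dual set)"
    unfolding open_dual_def by (auto intro!: exI[of _ "{}"] exI[of _ "1::real"])
next
  fix S T :: "'a dual set"
  assume S: "open S" and T: "open T"
  show "open (S \<inter> T)"
    unfolding open_dual_def
  proof
    fix \<gamma> assume \<gamma>: "\<gamma> \<in> S \<inter> T"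
    from S \<gamma> obtain K1 e1 where 1: "compact K1" "0 < e1"
      "{\<theta>. \<forall>x\<in>K1. dist \<langle>\<theta>, x\<rangle> \<langle>\<gamma>, x\<rangle> < e1} \<subseteq> S"
      unfolding open_dual_def by fast
    from T \<gamma> obtain K2 e2 where 2: "compact K2" "0 < e2"
      "{\<theta>. \<forall>x\<in>K2. dist \<langle>\<theta>, x\<rangle> \<langle>\<gamma>, x\<rangle> < e2} \<subseteq> T"
      unfolding open_dual_def by fast
    have "{\<theta>. \<forall>x\<in>K1 \<union> K2. dist \<langle>\<theta>, x\<rangle> \<langle>\<gamma>, x\<rangle> < min e1 e2} \<subseteq> S \<inter> T"
      using 1(3) 2(3) by auto
    moreover have "compact (K1 \<union> K2)" "0 < min e1 e2" using 1 2 by auto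
    ultimately show "\<exists>K \<epsilon>. compact K \<and> 0 < \<epsilon> \<and>
      {\<theta>. \<forall>x\<in>K. dist \<langle>\<theta>, x\<rangle> \<langle>\<gamma>, x\<rangle> < \<epsilon>} \<subseteq> S \<inter> T" by blast
  qed
next
  fix \<K> :: "'a dual set set"
  assume *: "\<forall>S\<in>\<K>. open S"
  show "open (\<Union>\<K>)"
    unfolding open_dual_def
  proof
    fix \<gamma> assume "\<gamma> \<in> \<Union>\<K>"
    then obtain S where S: "S \<in> \<K>" "\<gamma> \<in> S" by blast
    with * obtain K e where "compact K" "0 < e"
      "{\<theta>. \<forall>x\<in>K. dist \<langle>\<theta>, x\<rangle> \<langle>\<gamma>, x\<rangle> < e} \<subseteq> S"
      unfolding open_dual_def by meson
    with S show "\<exists>K \<epsilon>. compact K \<and> 0 < \<epsilon> \<and>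
      {\<theta>. \<forall>x\<in>K. dist \<langle>\<theta>, x\<rangle> \<langle>\<gamma>, x\<rangle> < \<epsilon>} \<subseteq> \<Union>\<K>" by blast
  qed
qed

end

lemma eventually_nhds_dual:
  "eventually P (nhds \<gamma>) \<longleftrightarrow>
    (\<exists>K \<epsilon>. compact K \<and> 0 < \<epsilon> \<and> (\<forall>\<theta>. (\<forall>x\<in>K. dist \<langle>\<theta>, x\<rangle> \<langle>\<gamma>, x\<rangle> < \<epsilon>) \<longrightarrow> P \<theta>))"
  (is "?L \<longleftrightarrow> ?R")
proof
  assume ?L
  then obtain S where S: "open S" "\<gamma> \<in> S" "\<forall>\<theta>\<in>S. P \<theta>"
    unfolding eventually_nhds by blast
  then obtain K e where "compact K" "0 < e" "{\<theta>. \<forall>x\<in>K. dist \<langle>\<theta>, x\<rangle> \<langle>\<gamma>, x\<rangle> < e} \<subseteq> S"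
    unfolding open_dual_def by meson
  with S show ?R by blast
next
  assume ?R
  then obtain K e where K: "compact K" "0 < e"
    and P: "\<And>\<theta>. (\<forall>x\<in>K. dist \<langle>\<theta>, x\<rangle> \<langle>\<gamma>, x\<rangle> < e) \<Longrightarrow> P \<theta>" by blast
  define S where
    "S = {\<theta>. \<exists>d>0. \<forall>\<psi>. (\<forall>x\<in>K. dist \<langle>\<psi>, x\<rangle> \<langle>\<theta>, x\<rangle> < d) \<longrightarrow> P \<psi>}"
  have "open S"
    unfolding open_dual_def
  proof
    fix \<theta> assume "\<theta> \<in> S"
    then obtain d where d: "d > 0"
      and Pd: "\<And>\<psi>. (\<forall>x\<in>K. dist \<langle>\<psi>, x\<rangle> \<langle>\<theta>, x\<rangle> < d) \<Longrightarrow> P \<psi>"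
      unfolding S_def by blast
    have "{\<phi>. \<forall>x\<in>K. dist \<langle>\<phi>, x\<rangle> \<langle>\<theta>, x\<rangle> < d / 2} \<subseteq> S"
    proof
      fix \<phi> assume \<phi>: "\<phi> \<in> {\<phi>. \<forall>x\<in>K. dist \<langle>\<phi>, x\<rangle> \<langle>\<theta>, x\<rangle> < d / 2}"
      have "P \<psi>" if "\<forall>x\<in>K. dist \<langle>\<psi>, x\<rangle> \<langle>\<phi>, x\<rangle> < d / 2" for \<psi>
      proof (rule Pd, rule ballI)
        fix x assume "x \<in> K"
        with \<phi> that have "dist \<langle>\<psi>, x\<rangle> \<langle>\<phi>, x\<rangle> < d / 2" "dist \<langle>\<phi>, x\<rangle> \<langle>\<theta>, x\<rangle> < d / 2" by auto
        then show "dist \<langle>\<psi>, x\<rangle> \<langle>\<theta>, x\<rangle> < d"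
          using dist_triangle[of "\<langle>\<psi>, x\<rangle>" "\<langle>\<theta>, x\<rangle>" "\<langle>\<phi>, x\<rangle>"] by linarith
      qed
      with d show "\<phi> \<in> S" unfolding S_def by (auto intro!: exI[of _ "d / 2"])
    qed
    with K d show "\<exists>K \<epsilon>. compact K \<and> 0 < \<epsilon> \<and>
      {\<phi>. \<forall>x\<in>K. dist \<langle>\<phi>, x\<rangle> \<langle>\<theta>, x\<rangle> < \<epsilon>} \<subseteq> S"
      by (intro exI[of _ K] exI[of _ "d / 2"]) auto
  qed
  moreover have "\<gamma> \<in> S" unfolding S_def using K P by blast
  moreover have "P \<theta>" if "\<theta> \<in> S" for \<theta>
    using that unfolding S_def by auto
  ultimately show ?L unfolding eventually_nhds by blast
qed

lemma tendsto_pairing_nhds: "((\<lambda>\<gamma>. \<langle>\<gamma>, x\<rangle>) \<longlongrightarrow> \<langle>\<gamma>0, x\<rangle>) (nhds \<gamma>0)"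
  unfolding tendsto_iff eventually_nhds_dual
  by (intro allI impI exI[of _ "{x}"]) auto

lemma continuous_pairing_left: "continuous_on UNIV (\<lambda>\<gamma>. \<langle>\<gamma>, x\<rangle>)"
  unfolding continuous_on_def
  by (auto intro: tendsto_mono[OF _ tendsto_pairing_nhds] simp: at_within_def)

lemma borel_measurable_pairing [measurable]: "(\<lambda>\<gamma>. \<langle>\<gamma>, x\<rangle>) \<in> borel_measurable borel"
  by (rule borel_measurable_continuous_onI[OF continuous_pairing_left])

instance dual :: (topological_ab_group_add) t2_space
proof
  fix \<gamma> \<theta> :: "'a dual"
  assume "\<gamma> \<noteq> \<theta>"
  then obtain x where "\<langle>\<gamma>, x\<rangle> \<noteq> \<langle>\<theta>, x\<rangle>" by (meson dual_eqI)
  then obtain U V where "open U" "open V" "\<langle>\<gamma>, x\<rangle> \<in> U" "\<langle>\<theta>, x\<rangle> \<in> V" "U \<inter> V = {}"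
    using hausdorff by metis
  moreover from this have "open ((\<lambda>\<gamma>. \<langle>\<gamma>, x\<rangle>) -` U)" "open ((\<lambda>\<gamma>. \<langle>\<gamma>, x\<rangle>) -` V)"
    by (auto intro: open_vimage continuous_pairing_left)
  ultimately show "\<exists>U V. open U \<and> open V \<and> \<gamma> \<in> U \<and> \<theta> \<in> V \<and> U \<inter> V = {}"
    by (intro exI[of _ "(\<lambda>\<gamma>. \<langle>\<gamma>, x\<rangle>) -` U"] exI[of _ "(\<lambda>\<gamma>. \<langle>\<gamma>, x\<rangle>) -` V"]) auto
qed

instance dual :: (topological_ab_group_add) topological_ab_group_add
proof
  fix a b :: "'a dual"
  show "((\<lambda>p. fst p + snd p) \<longlongrightarrow> a + b) (nhds a \<times>\<^sub>F nhds b)"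
    unfolding filterlim_iff
  proof (intro allI impI)
    fix P assume "eventually P (nhds (a + b))"
    then obtain K e where K: "compact K" "0 < e"
      and P: "\<And>\<theta>. (\<forall>x\<in>K. dist \<langle>\<theta>, x\<rangle> \<langle>a + b, x\<rangle> < e) \<Longrightarrow> P \<theta>"
      unfolding eventually_nhds_dual by blast
    have ev: "\<forall>\<^sub>F \<theta> in nhds c. \<forall>x\<in>K. dist \<langle>\<theta>, x\<rangle> \<langle>c, x\<rangle> < e / 2" for c :: "'a dual"
      unfolding eventually_nhds_dual using K by (intro exI[of _ K] exI[of _ "e / 2"]) auto
    show "\<forall>\<^sub>F p in nhds a \<times>\<^sub>F nhds b. P (fst p + snd p)"
      unfolding eventually_prod_filter
    proof (intro exI conjI allI impI)
      show "\<forall>\<^sub>F \<theta> in nhds a. \<forall>x\<in>K. dist \<langle>\<theta>, x\<rangle> \<langle>a, x\<rangle> < e / 2" by (rule ev)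
      show "\<forall>\<^sub>F \<theta> in nhds b. \<forall>x\<in>K. dist \<langle>\<theta>, x\<rangle> \<langle>b, x\<rangle> < e / 2" by (rule ev)
      fix \<theta> \<psi>
      assume 1: "\<forall>x\<in>K. dist \<langle>\<theta>, x\<rangle> \<langle>a, x\<rangle> < e / 2"
        and 2: "\<forall>x\<in>K. dist \<langle>\<psi>, x\<rangle> \<langle>b, x\<rangle> < e / 2"
      have "P (\<theta> + \<psi>)"
      proof (rule P, rule ballI)
        fix x assume x: "x \<in> K"
        have "\<langle>\<theta> + \<psi>, x\<rangle> - \<langle>a + b, x\<rangle> =
            \<langle>\<theta>, x\<rangle> * (\<langle>\<psi>, x\<rangle> - \<langle>b, x\<rangle>) + (\<langle>\<theta>, x\<rangle> - \<langle>a, x\<rangle>) * \<langle>b, x\<rangle>"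
          by (simp add: pairing_add_left algebra_simps)
        also have "cmod \<dots> \<le> cmod (\<langle>\<psi>, x\<rangle> - \<langle>b, x\<rangle>) + cmod (\<langle>\<theta>, x\<rangle> - \<langle>a, x\<rangle>)"
          by (rule norm_triangle_le) (simp add: norm_mult)
        also have "\<dots> < e" using 1[rule_format, OF x] 2[rule_format, OF x]
          by (simp add: dist_norm)
        finally show "dist \<langle>\<theta> + \<psi>, x\<rangle> \<langle>a + b, x\<rangle> < e" by (simp add: dist_norm)
      qed
      then show "P (fst (\<theta>, \<psi>) + snd (\<theta>, \<psi>))" by simp
    qed
  qed
  have d: "dist \<langle>- \<theta>, x\<rangle> \<langle>- a, x\<rangle> = dist \<langle>\<theta>, x\<rangle> \<langle>a, x\<rangle>" for \<theta> and x :: 'a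
    by (metis complex_cnj_diff complex_mod_cnj dist_norm pairing_uminus_left)
  show "(uminus \<longlongrightarrow> - a) (nhds a)"
    unfolding filterlim_iff eventually_nhds_dual using d by metis
qed

section \<open>Subgroups, cosets, annihilators and transversals\<close>

definition add_subgroup :: "'a::ab_group_add set \<Rightarrow> bool" where
  "add_subgroup H \<longleftrightarrow> 0 \<in> H \<and> (\<forall>x\<in>H. \<forall>y\<in>H. x + y \<in> H) \<and> (\<forall>x\<in>H. - x \<in> H)"

definition cosets_of :: "'a::ab_group_add set \<Rightarrow> 'a set set" where
  "cosets_of H = range (\<lambda>x. x +o H)"

definition annihilator :: "'g::topological_ab_group_add set \<Rightarrow> 'g dual set" where
  "annihilator H = {\<gamma>. \<forall>y\<in>H. \<langle>\<gamma>, y\<rangle> = 1}"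

lemma add_subgroup_annihilator: "add_subgroup (annihilator H)"
  by (auto simp: add_subgroup_def annihilator_def pairing_add_left pairing_uminus_left)

definition transversal :: "'a::ab_group_add set \<Rightarrow> 'a set \<Rightarrow> bool" where
  "transversal \<Lambda> T \<longleftrightarrow> (\<forall>C\<in>cosets_of \<Lambda>. \<exists>!t. t \<in> T \<inter> C)"

section \<open>Measures on the Borel sets of the dual group\<close>

definition finite_regular_borel :: "'a::topological_space measure \<Rightarrow> bool" where
  "finite_regular_borel \<mu> \<longleftrightarrow> finite_measure \<mu> \<and> sets \<mu> = sets borel \<and>
     (\<forall>B\<in>sets borel. \<forall>\<epsilon>>0. \<exists>K U. compact K \<and> open U \<and> K \<subseteq> B \<and> B \<subseteq> U \<and>
        measure \<mu> (U - K) < \<epsilon>)"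

text \<open>The measures \<open>B \<mapsto> \<mu> (B \<inter> (T + \<kappa>))\<close> and \<open>B \<mapsto> mu_part (\<kappa> + B)\<close> and the countable
  sum of the latter; see \<open>emeasure_mu_part\<close>, \<open>emeasure_nu_part\<close> and \<open>emeasure_nu_sum\<close> below.\<close>

definition mu_part :: "'a::topological_ab_group_add measure \<Rightarrow> 'a set \<Rightarrow> 'a \<Rightarrow> 'a measure" where
  "mu_part \<mu> T \<kappa> = density \<mu> (indicator (\<kappa> +o T))"

definition nu_part :: "'a::topological_ab_group_add measure \<Rightarrow> 'a set \<Rightarrow> 'a \<Rightarrow> 'a measure" where
  "nu_part \<mu> T \<kappa> = distr (mu_part \<mu> T \<kappa>) borel (\<lambda>\<gamma>. \<gamma> - \<kappa>)"

definition nu_sum :: "'a::topological_ab_group_add measure \<Rightarrow> 'a set \<Rightarrow> 'a set \<Rightarrow> 'a measure" where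
  "nu_sum \<mu> T \<Lambda> = measure_of UNIV (sets borel)
     (\<lambda>B. \<Sum>\<^sub>\<infinity>\<kappa>\<in>\<Lambda>. emeasure (nu_part \<mu> T \<kappa>) B)"

lemma measurable_translate:
  "(\<lambda>\<gamma>. \<gamma> + c) \<in> borel_measurable borel" "(\<lambda>\<gamma>. \<gamma> - c) \<in> borel_measurable borel"
  for c :: "'a::{topological_ab_group_add, t2_space}"
  by (intro borel_measurable_continuous_onI continuous_intros)+

lemma translate_eq_vimage: "c +o B = (\<lambda>\<gamma>. \<gamma> - c) -` B" for c :: "'a::ab_group_add"
  by (auto simp: elt_set_plus_def algebra_simps intro: bexI[of _ "_ - c"])

lemma translate_in_borel:
  "B \<in> sets borel \<Longrightarrow> c +o B \<in> sets borel" for c :: "'a::{topological_ab_group_add, t2_space}"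
  using measurable_sets[OF measurable_translate(2)[of c], of B]
  by (simp add: translate_eq_vimage)

lemma sets_mu_part [simp]: "sets (mu_part \<mu> T \<kappa>) = sets \<mu>"
  by (simp add: mu_part_def)

lemma sets_nu_part [simp]: "sets (nu_part \<mu> T \<kappa>) = sets borel"
  by (simp add: nu_part_def)

lemma emeasure_mu_part:
  fixes T B :: "'a::{topological_ab_group_add, t2_space} set"
  assumes "sets \<mu> = sets borel" "T \<in> sets borel" "B \<in> sets borel"
  shows "emeasure (mu_part \<mu> T \<kappa>) B = emeasure \<mu> (B \<inter> (\<kappa> +o T))"
proof -
  have "\<kappa> +o T \<in> sets \<mu>" "B \<in> sets \<mu>" using assms translate_in_borel by auto
  then show ?thesis
    unfolding mu_part_def
    by (subst emeasure_density)
      (auto simp flip: indicator_inter_arith simp: Int_commute)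
qed

lemma emeasure_nu_part:
  fixes T B :: "'a::{topological_ab_group_add, t2_space} set"
  assumes "sets \<mu> = sets borel" "B \<in> sets borel"
  shows "emeasure (nu_part \<mu> T \<kappa>) B = emeasure (mu_part \<mu> T \<kappa>) (\<kappa> +o B)"
proof -
  have "(\<lambda>\<gamma>. \<gamma> - \<kappa>) \<in> measurable (mu_part \<mu> T \<kappa>) borel"
    using measurable_translate(2)[of \<kappa>] assms(1)
    by (simp cong: measurable_cong_sets)
  moreover have "space (mu_part \<mu> T \<kappa>) = UNIV"
    using sets_eq_imp_space_eq[OF assms(1)] by (simp add: mu_part_def)
  ultimately show ?thesis
    unfolding nu_part_def using assms(2) by (simp add: emeasure_distr translate_eq_vimage)
qed

lemma infsum_eq_nn_integral_count_space:
  fixes f :: "'a \<Rightarrow> ennreal"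
  assumes "countable A"
  shows "infsum f A = (\<integral>\<^sup>+ x. f x \<partial>count_space A)"
proof (cases "finite A")
  case True
  then show ?thesis by (simp add: nn_integral_count_space_finite)
next
  case False
  then have bij: "bij_betw (from_nat_into A) UNIV A"
    using assms by (rule bij_betw_from_nat_into[rotated])
  have "infsum f A = (\<Sum>\<^sub>\<infinity>n. f (from_nat_into A n))"
    using infsum_reindex_bij_betw[OF bij, of f] by simp
  also have "\<dots> = (\<Sum>n. f (from_nat_into A n))"
    by (rule sums_unique, rule has_sum_imp_sums, rule has_sum_infsum)
      (rule nonneg_summable_on_complete, simp)
  also have "\<dots> = (\<integral>\<^sup>+ x. f x \<partial>count_space A)"
    using nn_integral_bij_count_space[OF bij, of f] by (simp add: nn_integral_count_space_nat)
  finally show ?thesis .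
qed

lemma sets_nu_sum [simp]: "sets (nu_sum \<mu> T \<Lambda>) = sets borel"
  using sets.sigma_sets_eq[of borel] by (simp add: nu_sum_def sets_measure_of_conv)

lemma emeasure_nu_sum:
  assumes "countable \<Lambda>" "B \<in> sets borel"
  shows "emeasure (nu_sum \<mu> T \<Lambda>) B = (\<Sum>\<^sub>\<infinity>\<kappa>\<in>\<Lambda>. emeasure (nu_part \<mu> T \<kappa>) B)"
  unfolding nu_sum_def
proof (rule emeasure_measure_of_sigma)
  show "sigma_algebra UNIV (sets borel)"
    using sets.sigma_algebra_axioms[of borel] by simp
  show "positive (sets borel) (\<lambda>B. \<Sum>\<^sub>\<infinity>\<kappa>\<in>\<Lambda>. emeasure (nu_part \<mu> T \<kappa>) B)"
    by (simp add: positive_def)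
  show "countably_additive (sets borel) (\<lambda>B. \<Sum>\<^sub>\<infinity>\<kappa>\<in>\<Lambda>. emeasure (nu_part \<mu> T \<kappa>) B)"
    unfolding countably_additive_def infsum_eq_nn_integral_count_space[OF assms(1)]
  proof (intro allI impI)
    fix A :: "nat \<Rightarrow> 'a set"
    assume "range A \<subseteq> sets borel" "disjoint_family A" "\<Union> (range A) \<in> sets borel"
    then show "(\<Sum>i. \<integral>\<^sup>+ \<kappa>. emeasure (nu_part \<mu> T \<kappa>) (A i) \<partial>count_space \<Lambda>) =
        (\<integral>\<^sup>+ \<kappa>. emeasure (nu_part \<mu> T \<kappa>) (\<Union> (range A)) \<partial>count_space \<Lambda>)"
      by (subst nn_integral_suminf[symmetric]) (auto simp: suminf_emeasure)
  qed
qed (use assms in auto)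

section \<open>Square integrable functions and trigonometric polynomials\<close>

text \<open>Elements of \<open>L\<^sup>2(\<mu>)\<close> are represented by Borel functions. Closures are taken with respect to
  the seminorm and are thus invariant under \<open>\<mu>\<close>-a.e. equality, and the inner product only depends
  on the \<open>\<mu>\<close>-classes of its arguments.\<close>

definition L2 :: "'a::topological_space measure \<Rightarrow> ('a \<Rightarrow> complex) set" where
  "L2 \<mu> = {f \<in> borel_measurable borel. integrable \<mu> (\<lambda>\<gamma>. (cmod (f \<gamma>))\<^sup>2)}"

definition L2_inner ::
    "'a::topological_space measure \<Rightarrow> ('a \<Rightarrow> complex) \<Rightarrow> ('a \<Rightarrow> complex) \<Rightarrow> complex" where
  "L2_inner \<mu> f g = (\<integral>\<gamma>. f \<gamma> * cnj (g \<gamma>) \<partial>\<mu>)"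

definition L2_norm :: "'a::topological_space measure \<Rightarrow> ('a \<Rightarrow> complex) \<Rightarrow> real" where
  "L2_norm \<mu> f = sqrt (\<integral>\<gamma>. (cmod (f \<gamma>))\<^sup>2 \<partial>\<mu>)"

definition L2_closure ::
    "'a::topological_space measure \<Rightarrow> ('a \<Rightarrow> complex) set \<Rightarrow> ('a \<Rightarrow> complex) set" where
  "L2_closure \<mu> L = {f \<in> L2 \<mu>. \<forall>\<epsilon>>0. \<exists>g \<in> L \<inter> L2 \<mu>. L2_norm \<mu> (\<lambda>\<gamma>. f \<gamma> - g \<gamma>) < \<epsilon>}"

definition L2_orthogonal ::
    "'a::topological_space measure \<Rightarrow> ('a \<Rightarrow> complex) set \<Rightarrow> ('a \<Rightarrow> complex) set \<Rightarrow> bool" where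
  "L2_orthogonal \<mu> L M \<longleftrightarrow> (\<forall>f\<in>L. \<forall>g\<in>M. L2_inner \<mu> f g = 0)"

definition trig_poly :: "'g::topological_ab_group_add set \<Rightarrow> ('g dual \<Rightarrow> complex) set" where
  "trig_poly S = {\<lambda>\<gamma>. \<Sum>s\<in>F. a s * \<langle>\<gamma>, s\<rangle> | F a. finite F \<and> F \<subseteq> S}"

lemma trig_poly_subset_L2:
  assumes "finite_measure \<mu>" "sets \<mu> = sets borel"
  shows "trig_poly S \<subseteq> L2 \<mu>"
proof
  interpret finite_measure \<mu> by fact
  fix p assume "p \<in> trig_poly S"
  then obtain F a where F: "finite F" and p: "p = (\<lambda>\<gamma>. \<Sum>s\<in>F. a s * \<langle>\<gamma>, s\<rangle>)"
    unfolding trig_poly_def by blast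
  have [measurable]: "p \<in> borel_measurable borel" unfolding p by measurable
  have "cmod (p \<gamma>) \<le> (\<Sum>s\<in>F. cmod (a s))" for \<gamma>
    unfolding p by (rule norm_sum[THEN order_trans]) (simp add: norm_mult)
  then have "(cmod (p \<gamma>))\<^sup>2 \<le> (\<Sum>s\<in>F. cmod (a s))\<^sup>2" for \<gamma>
    by (simp add: power_mono)
  moreover have "(\<lambda>\<gamma>. (cmod (p \<gamma>))\<^sup>2) \<in> borel_measurable \<mu>"
    using assms(2) by (subst measurable_cong_sets[OF assms(2) refl]) measurable
  ultimately have "integrable \<mu> (\<lambda>\<gamma>. (cmod (p \<gamma>))\<^sup>2)"
    by (intro integrable_const_bound[where B = "(\<Sum>s\<in>F. cmod (a s))\<^sup>2"]) auto
  then show "p \<in> L2 \<mu>" unfolding L2_def by simp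
qed

text \<open>The spaces are indexed by the cosets themselves: equal spaces belonging to different cosets
  must be orthogonal to each other, too.\<close>

definition pairwise_orthogonal_cosets ::
    "'g::topological_ab_group_add dual measure \<Rightarrow> 'g set \<Rightarrow> bool" where
  "pairwise_orthogonal_cosets \<mu> H \<longleftrightarrow>
     pairwise (\<lambda>C D. L2_orthogonal \<mu> (L2_closure \<mu> (trig_poly C)) (L2_closure \<mu> (trig_poly D)))
       (cosets_of H)"

text \<open>\<open>h\<close> is a version of \<open>d\<rho>/d\<nu>\<close> that is everywhere finite and vanishes off \<open>T\<close>.\<close>

definition RN_version_on ::
    "'a::topological_space set \<Rightarrow> 'a measure \<Rightarrow> 'a measure \<Rightarrow> ('a \<Rightarrow> real) \<Rightarrow> bool" where
  "RN_version_on T \<nu> \<rho> h \<longleftrightarrow> h \<in> borel_measurable borel \<and> (\<forall>\<gamma>. 0 \<le> h \<gamma>) \<and>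
     (\<forall>\<gamma>. \<gamma> \<notin> T \<longrightarrow> h \<gamma> = 0) \<and> density \<nu> (\<lambda>\<gamma>. ennreal (h \<gamma>)) = \<rho>"

end

theory Submission
  imports Defs
begin

text \<open>Two facts carry the theorem. By sesquilinearity and continuity of the inner product,
  orthogonality of the spaces attached to different cosets of \<open>H\<close> says that the Fourier-Stieltjes
  transform \<open>z \<mapsto> \<integral>\<langle>\<gamma>, z\<rangle> d\<mu>(\<gamma>)\<close> vanishes off \<open>H\<close> (\<open>pairwise_orthogonal_iff_fourier_zero\<close>).
  And this in turn says that \<open>\<mu>\<close> is invariant under translation by the annihilator \<open>\<Lambda>\<close> of \<open>H\<close>
  (\<open>annihilator_invariant_iff_fourier_zero\<close>): translating \<open>\<mu>\<close> by \<open>\<kappa> \<in> \<Lambda>\<close> multiplies the transform at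
  \<open>z\<close> by a conjugate of \<open>\<langle>\<kappa>, z\<rangle>\<close>, which is \<open>1\<close> for \<open>z \<in> H\<close>. If the transform vanishes off \<open>H\<close>, it is
  therefore unchanged by the translation, and so is \<open>\<mu>\<close>, because a finite regular measure is determined
  by its transform (\<open>fourier_transform_injective\<close>). If conversely \<open>\<mu>\<close> is invariant and \<open>z \<notin> H\<close>, then
  some \<open>\<kappa> \<in> \<Lambda>\<close> has \<open>\<langle>\<kappa>, z\<rangle> \<noteq> 1\<close> (\<open>annihilator_separates_points\<close>), and the transform at \<open>z\<close> is \<open>0\<close>.

  As \<open>\<Gamma>\<close> is the disjoint union of the translates \<open>\<kappa> + T\<close>, invariance of \<open>\<mu>\<close> means that all the
  measures \<open>\<nu>\<^sub>\<kappa>\<close> coincide (\<open>invariant_iff_nu_parts_equal\<close>). For \<open>n\<close> elements of \<open>\<Lambda>\<close> this means that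
  each of them is \<open>\<nu> / n\<close>, that is \<open>h\<^sub>\<kappa> = 1 / n\<close> almost everywhere. For infinite \<open>\<Lambda>\<close> the finite total
  mass of \<open>\<mu>\<close> would be an infinite sum of equal numbers, so that \<open>\<mu> = 0\<close>.

  The deep ingredient is that the characters of the locally compact abelian group \<open>G / H\<close> separate
  points. In its proof, counting replaces integration over the group. A finite set \<open>R\<close> inside a small neighbourhood
  \<open>V\<close> that is almost invariant under finitely many prescribed small elements takes over the role of
  normalised Haar measure on \<open>V\<close>; such sets exist because boxes in finitely generated abelian groups
  grow polynomially (\<open>relative_Folner_set\<close>). The autocorrelation of \<open>R\<close> is a positive definite function
  \<open>\<phi>\<close> on the discrete group \<open>G\<close> which is close to \<open>1\<close> on small elements and vanishes at \<open>z\<close> if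
  \<open>R + z\<close> misses \<open>R\<close>. Maximising over all positive definite functions a functional that rewards these
  two properties gives functions with the same properties that are multiplicative against any finite set of elements
  (\<open>multiplicative_maximizer\<close>), and by compactness there is a homomorphism \<open>\<xi>\<close> from \<open>G\<close> to the circle
  with \<open>Re \<xi> \<ge> 1/2\<close> on a neighbourhood of \<open>0\<close> containing \<open>H\<close> and \<open>Re (\<xi> z) \<le> 1/2\<close>. Such a homomorphism
  is automatically continuous, and trivial on \<open>H\<close>.\<close>

section \<open>Almost invariant finite sets\<close>

text \<open>If \<open>f\<close> more than doubled over every step of length \<open>k\<close>, then \<open>2\<^sup>j \<le> f (j k) \<le> (j k + 1)\<^sup>d\<close> for
  all \<open>j\<close>.\<close>

lemma polynomial_growth_doubling:
  fixes f :: "nat \<Rightarrow> nat"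
  assumes pos: "\<And>m. 0 < f m" and bound: "\<And>m. f m \<le> (m + 1) ^ d"
  obtains m where "f (m + k) \<le> 2 * f m"
proof (rule ccontr)
  assume "\<not> thesis"
  then have step: "2 * f m < f (m + k)" for m
    using that not_le by blast
  have exp: "2 ^ j \<le> f (j * k)" for j
  proof (induction j)
    case (Suc j)
    then show ?case using step[of "j * k"] by (simp add: add.commute)
  qed (use pos[of 0] in simp)
  have lim: "(\<lambda>j. real ((j * k + 1) ^ d) / 2 ^ j) \<longlonglongrightarrow> 0"
  proof (rule Lim_null_comparison)
    show "\<forall>\<^sub>F j in sequentially. norm (real ((j * k + 1) ^ d) / 2 ^ j)
        \<le> (real k + 1) ^ d * (real j ^ d / 2 ^ j)"
    proof (rule eventually_sequentiallyI[of 1])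
      fix j :: nat
      assume "1 \<le> j"
      then have "real (j * k + 1) \<le> (real k + 1) * real j" by (simp add: algebra_simps)
      then have "real (j * k + 1) ^ d \<le> ((real k + 1) * real j) ^ d"
        by (rule power_mono) simp
      then show "norm (real ((j * k + 1) ^ d) / 2 ^ j) \<le> (real k + 1) ^ d * (real j ^ d / 2 ^ j)"
        by (simp add: power_mult_distrib divide_right_mono)
    qed
    have "(\<lambda>j. real j ^ d / 2 ^ j) \<longlonglongrightarrow> 0"
      by real_asymp
    then show "(\<lambda>j. (real k + 1) ^ d * (real j ^ d / 2 ^ j)) \<longlonglongrightarrow> 0"
      using tendsto_mult_right_zero by blast
  qed
  have "\<forall>\<^sub>F j in sequentially. real ((j * k + 1) ^ d) / 2 ^ j < 1"
    using order_tendstoD(2)[OF lim, of 1] by simp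
  then obtain j where "real ((j * k + 1) ^ d) / 2 ^ j < 1"
    by (meson eventually_sequentially order_refl)
  then have "real ((j * k + 1) ^ d) < real (2 ^ j)" by (simp add: divide_simps)
  then have "(j * k + 1) ^ d < 2 ^ j" using of_nat_less_iff by blast
  with exp[of j] bound[of "j * k"] show False by linarith
qed

text \<open>Linear combinations of \<open>E\<close> with coefficients in \<open>{0..m}\<close>. Subtraction of an element \<open>c\<close> is available as
  soon as \<open>- c\<close> is put into \<open>E\<close>.\<close>

definition nat_box :: "'g::ab_group_add set \<Rightarrow> nat \<Rightarrow> 'g set" where
  "nat_box E m = (\<lambda>k. \<Sum>e\<in>E. \<Sum>i<k e. e) ` (E \<rightarrow>\<^sub>E {..m})"

lemma finite_nat_box: "finite E \<Longrightarrow> finite (nat_box E m)"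
  unfolding nat_box_def by (intro finite_imageI finite_PiE) auto

lemma card_nat_box_le: "finite E \<Longrightarrow> card (nat_box E m) \<le> (m + 1) ^ card E"
  unfolding nat_box_def
  by (rule order_trans[OF card_image_le]) (auto simp: card_PiE intro!: finite_PiE)

lemma zero_in_nat_box: "0 \<in> nat_box E m"
  unfolding nat_box_def
  by (rule image_eqI[of _ _ "\<lambda>e\<in>E. 0"]) auto

lemma nat_box_mono: "m \<le> m' \<Longrightarrow> nat_box E m \<subseteq> nat_box E m'"
  unfolding nat_box_def by (intro image_mono PiE_mono) auto

lemma add_in_nat_box:
  assumes "finite E" "e \<in> E" "x \<in> nat_box E m"
  shows "x + e \<in> nat_box E (Suc m)"
proof -
  obtain k where k: "k \<in> E \<rightarrow>\<^sub>E {..m}" and x: "x = (\<Sum>e\<in>E. \<Sum>i<k e. e)"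
    using assms(3) unfolding nat_box_def by blast
  define k' where "k' = k(e := Suc (k e))"
  have "k' \<in> E \<rightarrow>\<^sub>E {..Suc m}"
    using k assms(2) unfolding k'_def PiE_iff extensional_def by (auto simp: le_Suc_eq)
  moreover have "(\<Sum>e\<in>E. \<Sum>i<k' e. e) = x + e"
  proof -
    have "(\<Sum>e\<in>E - {e}. \<Sum>i<k' e. e) = (\<Sum>e\<in>E - {e}. \<Sum>i<k e. e)"
      by (rule sum.cong) (auto simp: k'_def)
    moreover have "(\<Sum>i<k' e. e) = (\<Sum>i<k e. e) + e" by (simp add: k'_def)
    ultimately show ?thesis
      unfolding x sum.remove[OF assms(1,2)] by (simp only: ac_simps)
  qed
  ultimately show ?thesis unfolding nat_box_def by (intro image_eqI[of _ _ k']) auto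
qed

text \<open>A finite set cannot be almost invariant under all elements of an uncountable \<open>W\<close>, but it can be for
  those in a finite set \<open>E\<close>. What matters is that \<open>n\<close>, and hence a possible \<open>W\<close>, depends on the number of translates of \<open>A 0\<close> covering
  \<open>A n\<close> but not on \<open>E\<close>.

  Let \<open>Q m\<close> be the boxes generated by \<open>E\<close> and \<open>- C\<close>, and choose \<open>M\<close> such that \<open>Q (M + n + 1)\<close> meets
  \<open>A 0\<close> in at most twice as many points as \<open>Q M\<close> does. The sets \<open>R N = Q (M + N) \<inter> A N\<close> increase, and
  adding an element of \<open>E \<inter> W\<close> leads from \<open>R N\<close> to \<open>R (N + 1)\<close>. By the covering, \<open>R n\<close> is at most
  \<open>2 |C|\<close> times as large as \<open>R 0\<close>, so that one of the \<open>n\<close> steps enlarges \<open>R N\<close> by a factor of at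
  most \<open>1 + \<epsilon>\<close>.\<close>

lemma relative_Folner_set:
  fixes A :: "nat \<Rightarrow> 'g::ab_group_add set"
  assumes "0 \<in> A 0" "0 \<in> W"
    and step: "\<And>k a w. k < n \<Longrightarrow> a \<in> A k \<Longrightarrow> w \<in> W \<Longrightarrow> a + w \<in> A (Suc k)"
    and "finite C" and cover: "A n \<subseteq> (\<Union>c\<in>C. (\<lambda>a. a + c) ` A 0)"
    and n: "2 * real (card C) < (1 + \<epsilon>) ^ n" and "0 \<le> \<epsilon>"
    and "finite E"
  obtains R where "finite R" "R \<noteq> {}" "R \<subseteq> A n"
    "\<And>x. x \<in> E \<Longrightarrow> x \<in> W \<Longrightarrow> real (card {r \<in> R. r + x \<notin> R}) \<le> \<epsilon> * real (card R)"
proof -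
  define E' where "E' = E \<union> uminus ` C"
  have E': "finite E'" using assms by (simp add: E'_def)
  define Q where "Q = nat_box E'"
  have finQ: "finite (Q m)" for m
    unfolding Q_def by (rule finite_nat_box[OF E'])
  have Qmono: "Q m \<subseteq> Q m'" if "m \<le> m'" for m m'
    unfolding Q_def by (rule nat_box_mono[OF that])
  have Qadd: "x + e \<in> Q (Suc m)" if "x \<in> Q m" "e \<in> E'" for x e m
    using that E' add_in_nat_box unfolding Q_def by blast
  \<comment> \<open>One more than \<open>n\<close>, since the covering argument below subtracts an element of \<open>C\<close>.\<close>
  obtain M where M: "card (Q (M + Suc n) \<inter> A 0) \<le> 2 * card (Q M \<inter> A 0)"
  proof (rule polynomial_growth_doubling[of "\<lambda>m. card (Q m \<inter> A 0)" "card E'" "Suc n"])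
    show "0 < card (Q m \<inter> A 0)" for m
      using finQ assms(1) zero_in_nat_box[of E' m] by (auto simp: card_gt_0_iff Q_def)
    show "card (Q m \<inter> A 0) \<le> (m + 1) ^ card E'" for m
      using card_mono[OF finQ, of "Q m \<inter> A 0" m] card_nat_box_le[OF E', of m]
      by (simp add: Q_def)
  qed blast
  define R where "R N = Q (M + N) \<inter> A N" for N
  have finR: "finite (R N)" for N using finQ by (simp add: R_def)
  have R0: "0 \<in> R 0" using assms(1) zero_in_nat_box by (auto simp: R_def Q_def)
  have A_mono: "A k \<subseteq> A (Suc k)" if "k < n" for k
    using step[OF that _ \<open>0 \<in> W\<close>] by auto
  have R_mono: "R k \<subseteq> R (Suc k)" if "k < n" for k
    using A_mono[OF that] Qmono[of "M + k" "M + Suc k"] by (auto simp: R_def)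
  have A_le: "A k \<subseteq> A n" if "k \<le> n" for k
    using that by (induction rule: inc_induct) (use A_mono in auto)
  have "card (R n) \<le> (\<Sum>c\<in>C. card (Q (M + Suc n) \<inter> A 0))"
  proof -
    have "R n \<subseteq> (\<Union>c\<in>C. (\<lambda>a. a + c) ` (Q (M + Suc n) \<inter> A 0))"
    proof
      fix r assume r: "r \<in> R n"
      then obtain c a where ca: "c \<in> C" "a \<in> A 0" "r = a + c" using cover by (auto simp: R_def)
      then have "r + - c \<in> Q (Suc (M + n))"
        using r by (intro Qadd) (auto simp: R_def E'_def)
      with ca show "r \<in> (\<Union>c\<in>C. (\<lambda>a. a + c) ` (Q (M + Suc n) \<inter> A 0))" by auto
    qed
    then have "card (R n) \<le> card (\<Union>c\<in>C. (\<lambda>a. a + c) ` (Q (M + Suc n) \<inter> A 0))"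
      using finQ \<open>finite C\<close> by (intro card_mono) auto
    also have "\<dots> \<le> (\<Sum>c\<in>C. card ((\<lambda>a. a + c) ` (Q (M + Suc n) \<inter> A 0)))"
      by (rule card_UN_le[OF \<open>finite C\<close>])
    also have "\<dots> \<le> (\<Sum>c\<in>C. card (Q (M + Suc n) \<inter> A 0))"
      by (intro sum_mono card_image_le) (use finQ in auto)
    finally show ?thesis .
  qed
  also have "\<dots> \<le> card C * (2 * card (R 0))" using M by (simp add: R_def)
  finally have Rn: "real (card (R n)) \<le> 2 * real (card C) * real (card (R 0))"
    using of_nat_mono[of "card (R n)" "card C * (2 * card (R 0))", where 'a = real]
    by (simp add: mult_ac)
  have posR0: "0 < real (card (R 0))" using R0 finR by (auto simp: card_gt_0_iff)
  have "\<exists>N<n. real (card (R (Suc N))) \<le> (1 + \<epsilon>) * real (card (R N))"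
  proof (rule ccontr)
    assume "\<not> ?thesis"
    then have big: "(1 + \<epsilon>) * real (card (R N)) < real (card (R (Suc N)))" if "N < n" for N
      using that by (auto simp: not_le)
    have "(1 + \<epsilon>) ^ N * real (card (R 0)) \<le> real (card (R N))" if "N \<le> n" for N
      using that
    proof (induction N)
      case (Suc N)
      then have "(1 + \<epsilon>) ^ Suc N * real (card (R 0)) \<le> (1 + \<epsilon>) * real (card (R N))"
        using \<open>0 \<le> \<epsilon>\<close> by (simp add: mult.assoc mult_left_mono)
      with big[of N] Suc.prems show ?case by simp
    qed simp
    from this[of n] Rn have "(1 + \<epsilon>) ^ n * real (card (R 0)) \<le> 2 * real (card C) * real (card (R 0))"
      by simp
    with posR0 n show False by (simp add: mult_le_cancel_right)
  qed
  then obtain N where N: "N < n" "real (card (R (Suc N))) \<le> (1 + \<epsilon>) * real (card (R N))" by blast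
  show thesis
  proof (rule that[of "R N"])
    show "finite (R N)" by (rule finR)
    have "0 \<in> R N" using \<open>N < n\<close>
    proof (induction N)
      case (Suc N) then show ?case using R_mono[of N] by auto
    qed (use R0 in auto)
    then show "R N \<noteq> {}" by auto
    show "R N \<subseteq> A n" using A_le[of N] N(1) by (auto simp: R_def)
    fix x assume x: "x \<in> E" "x \<in> W"
    have *: "r + x \<in> R (Suc N)" if "r \<in> R N" for r
      using that x Qadd[of r "M + N" x] step[OF N(1), of r x] by (auto simp: R_def E'_def)
    have "card {r \<in> R N. r + x \<notin> R N} = card ((\<lambda>r. r + x) ` {r \<in> R N. r + x \<notin> R N})"
      by (intro card_image[symmetric] inj_onI) simp
    also have "\<dots> \<le> card (R (Suc N) - R N)"
      using * finR by (intro card_mono) auto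
    also have "\<dots> = card (R (Suc N)) - card (R N)"
      by (rule card_Diff_subset[OF finR R_mono[OF N(1)]])
    finally have "real (card {r \<in> R N. r + x \<notin> R N}) \<le> real (card (R (Suc N))) - real (card (R N))"
      using card_mono[OF finR R_mono[OF N(1)]] by linarith
    with N(2) show "real (card {r \<in> R N. r + x \<notin> R N}) \<le> \<epsilon> * real (card (R N))"
      by (simp add: algebra_simps)
  qed
qed

section \<open>Positive definite functions on a discrete abelian group\<close>

text \<open>Positive definite functions on the discrete group. The points \<open>s i\<close> may coincide, so that the
  quadratic form is indexed by finitely supported measures \<open>\<Sum> a\<^sub>i \<delta>\<^bsub>s i\<^esub>\<close> and can be evaluated at sums of
  translates of such measures.\<close>

definition pos_def :: "('g::ab_group_add \<Rightarrow> complex) \<Rightarrow> bool" where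
  "pos_def \<phi> \<longleftrightarrow> (\<forall>x. \<phi> (- x) = cnj (\<phi> x)) \<and>
     (\<forall>n (s :: nat \<Rightarrow> 'g) a. 0 \<le> Re (\<Sum>i<n. \<Sum>j<n. a i * cnj (a j) * \<phi> (s i - s j)))"

lemma pos_def_uminus: "pos_def \<phi> \<Longrightarrow> \<phi> (- x) = cnj (\<phi> x)"
  by (simp add: pos_def_def)

lemma pos_def_form_nonneg:
  fixes n :: nat
  shows "pos_def \<phi> \<Longrightarrow> 0 \<le> Re (\<Sum>i<n. \<Sum>j<n. a i * cnj (a j) * \<phi> (s i - s j))"
  unfolding pos_def_def by blast

lemma pos_def_zero: "pos_def \<phi> \<Longrightarrow> \<phi> 0 = complex_of_real (Re (\<phi> 0))"
  using pos_def_uminus[of \<phi> 0] by (simp add: complex_eq_iff)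

text \<open>The form at the points \<open>0\<close> and \<open>x\<close>, with the coefficient of \<open>x\<close> chosen to make the mixed terms
  equal to \<open>- |\<phi> x|\<close>.\<close>

lemma norm_le_pos_def_zero:
  assumes "pos_def \<phi>"
  shows "cmod (\<phi> x) \<le> Re (\<phi> 0)"
proof -
  define a :: "nat \<Rightarrow> complex" where "a i = (if i = 0 then 1 else - cnj (sgn (\<phi> x)))" for i
  define s where "s i = (if i = 0 then 0 else x)" for i :: nat
  have 1: "a 1 * cnj (a 1) * \<phi> 0 = (cmod (sgn (\<phi> x)))\<^sup>2 * \<phi> 0"
    using complex_norm_square[of "sgn (\<phi> x)"] by (simp add: a_def mult.commute)
  have 2: "a 1 * \<phi> x = - cmod (\<phi> x)" "cnj (a 1) * cnj (\<phi> x) = - cmod (\<phi> x)"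
  proof -
    show "a 1 * \<phi> x = - cmod (\<phi> x)"
      using complex_norm_square[of "\<phi> x"]
      by (cases "\<phi> x = 0") (auto simp: a_def sgn_eq field_simps power2_eq_square)
    then show "cnj (a 1) * cnj (\<phi> x) = - cmod (\<phi> x)"
      by (metis complex_cnj_complex_of_real complex_cnj_minus complex_cnj_mult of_real_minus)
  qed
  have "0 \<le> Re (\<Sum>i<2. \<Sum>j<2. a i * cnj (a j) * \<phi> (s i - s j))"
    by (rule pos_def_form_nonneg[OF assms])
  also have "(\<Sum>i<2. \<Sum>j<2. a i * cnj (a j) * \<phi> (s i - s j)) =
      \<phi> 0 + cnj (a 1) * cnj (\<phi> x) + (a 1 * \<phi> x + a 1 * cnj (a 1) * \<phi> 0)"
    using pos_def_uminus[OF assms, of x]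
    by (simp add: numeral_2_eq_2 s_def) (simp add: a_def)
  also have "Re \<dots> = Re (\<phi> 0) * (1 + (cmod (sgn (\<phi> x)))\<^sup>2) - 2 * cmod (\<phi> x)"
    unfolding 1 2 by (simp add: algebra_simps)
  finally show ?thesis
    by (cases "\<phi> x = 0") (auto simp: norm_sgn)
qed

lemma sum_lessThan_double:
  fixes f :: "nat \<Rightarrow> 'a::comm_monoid_add"
  shows "(\<Sum>i<n + n. f i) = (\<Sum>i<n. f i) + (\<Sum>i<n. f (n + i))"
  using sum.atLeastLessThan_concat[of 0 n "n + n" f] sum.shift_bounds_nat_ivl[of f 0 n n]
  by (simp add: lessThan_atLeast0 add.commute)

text \<open>The form of the new function at \<open>\<Sum> a\<^sub>i \<delta>\<^bsub>s i\<^esub>\<close> is the form of \<open>\<phi>\<close> at the sum of this measure and \<open>c\<close>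
  times its translate by \<open>x\<close>. The functions for \<open>c\<close> and \<open>- c\<close> add up to \<open>4 \<phi>\<close>; this splitting plays
  the part of Schur's lemma.\<close>

lemma pos_def_translates:
  assumes "pos_def \<phi>" "cmod c = 1"
  shows "pos_def (\<lambda>y. 2 * \<phi> y + c * \<phi> (y + x) + cnj c * \<phi> (y - x))" (is "pos_def ?\<psi>")
  unfolding pos_def_def
proof (intro conjI allI)
  fix y
  have "\<phi> (- y + x) = cnj (\<phi> (y - x))" "\<phi> (- y - x) = cnj (\<phi> (y + x))"
    using pos_def_uminus[OF assms(1), of "y - x"] pos_def_uminus[OF assms(1), of "y + x"]
    by (simp_all only: minus_diff_eq minus_add_distrib diff_conv_add_uminus add.commute minus_minus)
  then show "?\<psi> (- y) = cnj (?\<psi> y)"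
    using pos_def_uminus[OF assms(1), of y] by simp
next
  fix n and s :: "nat \<Rightarrow> 'a" and a :: "nat \<Rightarrow> complex"
  define b where "b i = (if i < n then a i else c * a (i - n))" for i
  define t where "t i = (if i < n then s i else s (i - n) + x)" for i
  have cc: "c * cnj c = 1"
    using complex_norm_square[of c] assms(2) by simp
  have "0 \<le> Re (\<Sum>i<n + n. \<Sum>j<n + n. b i * cnj (b j) * \<phi> (t i - t j))"
    by (rule pos_def_form_nonneg[OF assms(1)])
  also have "(\<Sum>i<n + n. \<Sum>j<n + n. b i * cnj (b j) * \<phi> (t i - t j)) =
      (\<Sum>i<n. \<Sum>j<n. a i * cnj (a j) * ?\<psi> (s i - s j))"
    unfolding sum_lessThan_double sum.distrib[symmetric]
  proof (intro sum.cong refl)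
    fix i j assume ij: "i \<in> {..<n}" "j \<in> {..<n}"
    have "c * a i * cnj (c * a j) = (c * cnj c) * (a i * cnj (a j))" by simp
    then have *: "c * a i * cnj (c * a j) = a i * cnj (a j)" unfolding cc by simp
    have "b i * cnj (b j) * \<phi> (t i - t j) + b i * cnj (b (n + j)) * \<phi> (t i - t (n + j)) +
        (b (n + i) * cnj (b j) * \<phi> (t (n + i) - t j) +
         b (n + i) * cnj (b (n + j)) * \<phi> (t (n + i) - t (n + j))) =
       a i * cnj (a j) * \<phi> (s i - s j) + a i * cnj (c * a j) * \<phi> (s i - s j - x) +
       (c * a i * cnj (a j) * \<phi> (s i - s j + x) + (c * a i * cnj (c * a j)) * \<phi> (s i - s j))"
      using ij by (simp add: b_def t_def algebra_simps)
    also have "\<dots> = a i * cnj (a j) * ?\<psi> (s i - s j)"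
      unfolding * by (simp add: algebra_simps)
    finally show "b i * cnj (b j) * \<phi> (t i - t j) + b i * cnj (b (n + j)) * \<phi> (t i - t (n + j)) +
        (b (n + i) * cnj (b j) * \<phi> (t (n + i) - t j) +
         b (n + i) * cnj (b (n + j)) * \<phi> (t (n + i) - t (n + j))) =
       a i * cnj (a j) * ?\<psi> (s i - s j)" .
  qed
  finally show "0 \<le> Re (\<Sum>i<n. \<Sum>j<n. a i * cnj (a j) * ?\<psi> (s i - s j))" .
qed

lemma pos_def_scale:
  assumes "pos_def \<phi>" "0 \<le> (r::real)"
  shows "pos_def (\<lambda>y. r * \<phi> y)"
  unfolding pos_def_def
proof (intro conjI allI)
  show "r * \<phi> (- x) = cnj (r * \<phi> x)" for x
    using pos_def_uminus[OF assms(1), of x] by simp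
  fix n and s :: "nat \<Rightarrow> 'a" and a :: "nat \<Rightarrow> complex"
  have "(\<Sum>i<n. \<Sum>j<n. a i * cnj (a j) * (r * \<phi> (s i - s j))) =
      r * (\<Sum>i<n. \<Sum>j<n. a i * cnj (a j) * \<phi> (s i - s j))"
    by (simp add: sum_distrib_left mult_ac)
  then show "0 \<le> Re (\<Sum>i<n. \<Sum>j<n. a i * cnj (a j) * (r * \<phi> (s i - s j)))"
    using pos_def_form_nonneg[OF assms(1), of a s n] assms(2) by simp
qed

definition pd_states :: "('g::ab_group_add \<Rightarrow> complex) set" where
  "pd_states = {\<phi>. pos_def \<phi> \<and> \<phi> 0 = 1}"

lemma pd_states_norm_le_1: "\<phi> \<in> pd_states \<Longrightarrow> cmod (\<phi> x) \<le> 1"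
  using norm_le_pos_def_zero[of \<phi> x] by (simp add: pd_states_def)

text \<open>Compactness is meant in the topology of pointwise convergence and comes from Tychonoff's theorem, since all
  values lie in the unit disc.\<close>

lemma compact_pd_states: "compact (pd_states :: ('g::ab_group_add \<Rightarrow> complex) set)"
proof -
  have "compactin (product_topology (\<lambda>_. euclidean) UNIV) (PiE (UNIV :: 'g set) (\<lambda>_. cball (0::complex) 1))"
    unfolding compactin_PiE by simp
  then have cpt: "compact (PiE (UNIV :: 'g set) (\<lambda>_. cball (0::complex) 1))"
    by (simp add: euclidean_product_topology)
  have "closed (pd_states :: ('g \<Rightarrow> complex) set)"
    unfolding pd_states_def pos_def_def
    by (intro closed_Collect_conj closed_Collect_all closed_Collect_eq closed_Collect_le
        continuous_intros continuous_on_product_coordinates)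
  moreover have "pd_states \<subseteq> PiE (UNIV :: 'g set) (\<lambda>_. cball (0::complex) 1)"
    using pd_states_norm_le_1 by auto
  ultimately show ?thesis
    using compact_Int_closed[OF cpt, of pd_states] by (simp add: inf.absorb2)
qed

text \<open>The autocorrelation of the indicator function of \<open>R\<close>: its form at \<open>\<Sum> a\<^sub>i \<delta>\<^bsub>s i\<^esub>\<close> is the sum over \<open>m\<close> of
  the squared moduli of \<open>\<Sum> a\<^sub>i 1\<^sub>R(m + s i)\<close>.\<close>

lemma pos_def_correlation:
  fixes R :: "'g::ab_group_add set"
  assumes R: "finite R"
  shows "pos_def (\<lambda>x. of_nat (card {r \<in> R. r + x \<in> R}))"
  unfolding pos_def_def
proof (intro conjI allI)
  fix x
  have "card {r \<in> R. r + - x \<in> R} = card ((\<lambda>r. r + x) ` {r \<in> R. r + x \<in> R})"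
    by (rule arg_cong[where f = card]) (auto intro: image_eqI[of _ _ "_ - x"])
  also have "\<dots> = card {r \<in> R. r + x \<in> R}"
    by (intro card_image inj_onI) simp
  finally show "of_nat (card {r \<in> R. r + - x \<in> R}) = cnj (of_nat (card {r \<in> R. r + x \<in> R}) :: complex)"
    by simp
next
  fix n and s :: "nat \<Rightarrow> 'g" and a :: "nat \<Rightarrow> complex"
  define M where "M = (\<Union>j<n. (\<lambda>r. r - s j) ` R)"
  define e :: "'g \<Rightarrow> complex" where "e x = (if x \<in> R then 1 else 0)" for x
  have M: "finite M" using R by (simp add: M_def)
  have cnj_e: "cnj (e x) = e x" for x by (simp add: e_def)
  have corr: "of_nat (card {r \<in> R. r + (s i - s j) \<in> R}) = (\<Sum>m\<in>M. e (m + s i) * e (m + s j))"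
    if "j < n" for i j
  proof -
    have "{r \<in> R. r + (s i - s j) \<in> R} = (\<lambda>m. m + s j) ` {m \<in> M. m + s i \<in> R \<and> m + s j \<in> R}"
    proof (intro set_eqI iffI)
      fix r assume "r \<in> {r \<in> R. r + (s i - s j) \<in> R}"
      then show "r \<in> (\<lambda>m. m + s j) ` {m \<in> M. m + s i \<in> R \<and> m + s j \<in> R}"
        using that by (intro image_eqI[of _ _ "r - s j"]) (auto simp: M_def algebra_simps)
    qed (auto simp: algebra_simps)
    then have "card {r \<in> R. r + (s i - s j) \<in> R} = card {m \<in> M. m + s i \<in> R \<and> m + s j \<in> R}"
      by (simp add: card_image inj_on_def)
    also have "of_nat \<dots> = (\<Sum>m\<in>M. if m + s i \<in> R \<and> m + s j \<in> R then 1 else (0::complex))"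
      using M by (simp add: sum.If_cases Int_def)
    also have "\<dots> = (\<Sum>m\<in>M. e (m + s i) * e (m + s j))"
      by (rule sum.cong) (auto simp: e_def)
    finally show ?thesis .
  qed
  have "(\<Sum>i<n. \<Sum>j<n. a i * cnj (a j) * of_nat (card {r \<in> R. r + (s i - s j) \<in> R})) =
      (\<Sum>i<n. \<Sum>j<n. \<Sum>m\<in>M. (a i * e (m + s i)) * cnj (a j * e (m + s j)))"
    by (intro sum.cong refl) (simp add: corr cnj_e sum_distrib_left mult_ac)
  also have "\<dots> = (\<Sum>i<n. \<Sum>m\<in>M. \<Sum>j<n. (a i * e (m + s i)) * cnj (a j * e (m + s j)))"
    by (intro sum.cong refl sum.swap)
  also have "\<dots> = (\<Sum>m\<in>M. \<Sum>i<n. \<Sum>j<n. (a i * e (m + s i)) * cnj (a j * e (m + s j)))"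
    by (rule sum.swap)
  also have "\<dots> = (\<Sum>m\<in>M. (\<Sum>i<n. a i * e (m + s i)) * cnj (\<Sum>j<n. a j * e (m + s j)))"
    unfolding cnj_sum sum_product by simp
  also have "\<dots> = (\<Sum>m\<in>M. complex_of_real ((cmod (\<Sum>i<n. a i * e (m + s i)))\<^sup>2))"
    by (simp only: complex_norm_square)
  also have "Re \<dots> \<ge> 0"
    by (auto intro: sum_nonneg)
  finally show "0 \<le> Re (\<Sum>i<n. \<Sum>j<n. a i * cnj (a j) * of_nat (card {r \<in> R. r + (s i - s j) \<in> R}))" .
qed

lemma norm_convex_combination:
  fixes u v :: complex and t :: real
  shows "(cmod (t * u + (1 - t) * v))\<^sup>2 =
    t * (cmod u)\<^sup>2 + (1 - t) * (cmod v)\<^sup>2 - t * (1 - t) * (cmod (u - v))\<^sup>2"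
  unfolding cmod_power2 by (simp add: power2_eq_square algebra_simps)

text \<open>Extreme points of the set of normalised positive definite functions are characters. Instead of
  extreme points, a maximiser \<open>\<xi>\<close> of the linear functional perturbed by a small multiple of
  \<open>\<Sum>\<^bsub>y\<in>F\<^esub> |\<xi> y|\<^sup>2\<close> is used: strict convexity in the values on \<open>F\<close> makes \<open>\<xi>\<close> extreme as far as these values
  are concerned, so that every splitting of \<open>\<xi>\<close> into two positive definite functions is proportional on
  \<open>F\<close>. For the splittings into twisted translates this is multiplicativity.\<close>

lemma multiplicative_maximizer:
  fixes \<phi> :: "'g::ab_group_add \<Rightarrow> complex" and w :: "'g \<Rightarrow> real"
  assumes "finite F" "\<phi> \<in> pd_states" "0 < \<delta>"
  obtains \<xi> where "\<xi> \<in> pd_states" "\<And>x y. y \<in> F \<Longrightarrow> \<xi> (x + y) = \<xi> x * \<xi> y"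
    "(\<Sum>x\<in>S. w x * Re (\<phi> x)) - \<delta> \<le> (\<Sum>x\<in>S. w x * Re (\<xi> x))"
proof -
  define d where "d = \<delta> / (real (card F) + 1)"
  have d: "0 < d" "d * real (card F) \<le> \<delta>" using assms(3) by (auto simp: d_def field_simps)
  define l where "l \<psi> = (\<Sum>x\<in>S. w x * Re (\<psi> x))" for \<psi> :: "'g \<Rightarrow> complex"
  define N where "N \<psi> = (\<Sum>y\<in>F. (cmod (\<psi> y))\<^sup>2)" for \<psi> :: "'g \<Rightarrow> complex"
  have "continuous_on pd_states (\<lambda>\<psi>. l \<psi> + d * N \<psi>)"
    unfolding l_def N_def
    by (intro continuous_intros continuous_on_subset[OF continuous_on_product_coordinates]) auto
  then obtain \<xi> where \<xi>: "\<xi> \<in> pd_states"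
    and max: "\<And>\<psi>. \<psi> \<in> pd_states \<Longrightarrow> l \<psi> + d * N \<psi> \<le> l \<xi> + d * N \<xi>"
    using continuous_attains_sup[OF compact_pd_states, of "\<lambda>\<psi>. l \<psi> + d * N \<psi>"] assms(2) by blast
  have pd: "pos_def \<xi>" and one: "\<xi> 0 = 1" using \<xi> by (auto simp: pd_states_def)
  \<comment> \<open>If \<open>\<psi> / t\<close> and \<open>\<psi>' / (1 - t)\<close> differed on \<open>F\<close>, strict convexity would give one of them a larger value of
    the perturbed functional than their convex combination \<open>\<xi>\<close> has.\<close>
  have split: "\<psi> y = t * \<xi> y" if
    pd\<psi>: "pos_def \<psi>" and pd\<psi>': "pos_def \<psi>'" and sum: "\<And>y. \<psi> y + \<psi>' y = \<xi> y"
      and t: "\<psi> 0 = complex_of_real t" and y: "y \<in> F" for \<psi> \<psi>' t y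
  proof -
    have t': "\<psi>' 0 = complex_of_real (1 - t)" using sum[of 0] t one by (simp add: algebra_simps)
    have le: "cmod (\<psi> y) \<le> t" "cmod (\<psi>' y) \<le> 1 - t" for y
      using norm_le_pos_def_zero[OF pd\<psi>, of y] norm_le_pos_def_zero[OF pd\<psi>', of y] t t' by auto
    have "0 \<le> t" "0 \<le> 1 - t" using le[of 0] norm_ge_zero order_trans by blast+
    then consider "t = 0" | "t = 1" | "0 < t" "t < 1" by linarith
    then show ?thesis
    proof cases
      case 1
      then show ?thesis using le(1)[of y] by simp
    next
      case 2
      then show ?thesis using le(2)[of y] sum[of y] by simp
    next
      case 3
      define u where "u y = complex_of_real (1 / t) * \<psi> y" for y
      define v where "v y = complex_of_real (1 / (1 - t)) * \<psi>' y" for y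
      have u: "u \<in> pd_states" unfolding pd_states_def u_def
        using pos_def_scale[OF pd\<psi>, of "1 / t"] t 3 by auto
      have v: "v \<in> pd_states" unfolding pd_states_def v_def
        using pos_def_scale[OF pd\<psi>', of "1 / (1 - t)"] t' 3 by auto
      have \<psi>u: "\<psi> z = t * u z" for z using 3 by (simp add: u_def)
      have \<psi>v: "\<psi>' z = (1 - t) * v z" for z
        using 3 by (simp add: v_def)
      have \<xi>uv: "\<xi> z = t * u z + (1 - t) * v z" for z using sum[of z] \<psi>u \<psi>v by simp
      have l: "l \<xi> = t * l u + (1 - t) * l v"
        unfolding l_def \<xi>uv by (simp add: sum_distrib_left sum.distrib[symmetric] algebra_simps)
      have N: "N \<xi> = t * N u + (1 - t) * N v - t * (1 - t) * (\<Sum>y\<in>F. (cmod (u y - v y))\<^sup>2)"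
        unfolding N_def \<xi>uv using norm_convex_combination[of t]
        by (simp add: sum_distrib_left sum.distrib sum_subtractf)
      have "t * (l u + d * N u) + (1 - t) * (l v + d * N v)
          \<le> t * (l \<xi> + d * N \<xi>) + (1 - t) * (l \<xi> + d * N \<xi>)"
        by (rule add_mono[OF mult_left_mono[OF max[OF u]] mult_left_mono[OF max[OF v]]]) (use 3 in auto)
      also have "\<dots> = l \<xi> + d * N \<xi>" by (simp add: algebra_simps)
      also have "\<dots> = t * (l u + d * N u) + (1 - t) * (l v + d * N v)
          - d * (t * (1 - t) * (\<Sum>y\<in>F. (cmod (u y - v y))\<^sup>2))"
        unfolding l N by (simp add: algebra_simps)
      finally have "d * (t * (1 - t) * (\<Sum>y\<in>F. (cmod (u y - v y))\<^sup>2)) \<le> 0" by simp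
      then have "(\<Sum>y\<in>F. (cmod (u y - v y))\<^sup>2) \<le> 0"
        using d 3 by (simp add: mult_le_0_iff)
      then have "(\<Sum>y\<in>F. (cmod (u y - v y))\<^sup>2) = 0"
        by (intro antisym sum_nonneg) auto
      then have "(cmod (u y - v y))\<^sup>2 = 0"
        using y assms(1) by (subst (asm) sum_nonneg_eq_0_iff) auto
      then have "u y = v y" by simp
      then have "\<xi> y = u y" using \<xi>uv[of y] by (simp add: algebra_simps)
      then show ?thesis using \<psi>u by simp
    qed
  qed
  have twist: "c * \<xi> (y + x) + cnj c * \<xi> (y - x) = (c * \<xi> x + cnj c * cnj (\<xi> x)) * \<xi> y"
    if c: "cmod c = 1" and y: "y \<in> F" for c x y
  proof -
    define \<psi> where "\<psi> b y = complex_of_real (1 / 4) *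
      (2 * \<xi> y + b * \<xi> (y + x) + cnj b * \<xi> (y - x))" for b y
    have pd\<psi>: "pos_def (\<psi> b)" if "cmod b = 1" for b
      unfolding \<psi>_def by (rule pos_def_scale[OF pos_def_translates[OF pd that]]) simp
    have "\<psi> c y = Re (\<psi> c 0) * \<xi> y"
    proof (rule split[OF pd\<psi>[OF c] pd\<psi>[of "- c"] _ _ y])
      show "\<psi> c 0 = complex_of_real (Re (\<psi> c 0))" by (rule pos_def_zero[OF pd\<psi>[OF c]])
    qed (use c in \<open>auto simp: \<psi>_def algebra_simps\<close>)
    also have "complex_of_real (Re (\<psi> c 0)) = \<psi> c 0"
      by (rule pos_def_zero[OF pd\<psi>[OF c], symmetric])
    finally have "4 * \<psi> c y = 4 * \<psi> c 0 * \<xi> y" by simp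
    moreover have four: "4 * \<psi> c z = 2 * \<xi> z + c * \<xi> (z + x) + cnj c * \<xi> (z - x)" for z
      by (simp add: \<psi>_def)
    ultimately have "2 * \<xi> y + c * \<xi> (y + x) + cnj c * \<xi> (y - x) =
        (2 * \<xi> 0 + c * \<xi> (0 + x) + cnj c * \<xi> (0 - x)) * \<xi> y"
      unfolding four[symmetric] by (simp only:)
    then show ?thesis
      using pos_def_uminus[OF pd, of x] one by (simp add: algebra_simps)
  qed
  show thesis
  proof (rule that[OF \<xi>])
    fix x y assume y: "y \<in> F"
    have 1: "\<xi> (y + x) + \<xi> (y - x) = (\<xi> x + cnj (\<xi> x)) * \<xi> y"
      using twist[of 1 y x] y by simp
    have "\<i> * (\<xi> (y + x) - \<xi> (y - x)) = \<i> * ((\<xi> x - cnj (\<xi> x)) * \<xi> y)"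
      using twist[of \<i> y x] y by (simp add: algebra_simps)
    then have 2: "\<xi> (y + x) - \<xi> (y - x) = (\<xi> x - cnj (\<xi> x)) * \<xi> y" by simp
    have "2 * \<xi> (y + x) = 2 * (\<xi> x * \<xi> y)"
      using arg_cong2[where f = "(+)", OF 1 2] by (simp add: algebra_simps)
    then show "\<xi> (x + y) = \<xi> x * \<xi> y" by (simp add: add.commute)
  next
    have "0 \<le> d * N \<phi>" using d by (simp add: N_def sum_nonneg)
    moreover have "N \<xi> \<le> (\<Sum>y\<in>F. 1)"
      unfolding N_def by (intro sum_mono) (simp add: power_le_one pd_states_norm_le_1[OF \<xi>])
    then have "d * N \<xi> \<le> d * real (card F)" using d by simp
    ultimately have "l \<phi> - \<delta> \<le> l \<xi>"
      using max[OF assms(2)] d(2) by linarith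
    then show "(\<Sum>x\<in>S. w x * Re (\<phi> x)) - \<delta> \<le> (\<Sum>x\<in>S. w x * Re (\<xi> x))"
      by (simp only: l_def)
  qed
qed

section \<open>From almost invariant sets to homomorphisms into the circle\<close>

text \<open>The triangle inequality \<open>|1 - b| \<le> |1 - a b| + |1 - a|\<close>, squared; \<open>1 - Re c\<close> is at least half of
  \<open>|1 - c|\<^sup>2\<close> in the unit disc, with equality on the circle.\<close>

lemma one_minus_Re_quotient_le:
  assumes "cmod a \<le> 1" "cmod b = 1"
  shows "1 - Re b \<le> 2 * (1 - Re a) + 2 * (1 - Re (a * b))"
proof -
  have sq: "(cmod (1 - c))\<^sup>2 = 1 + (cmod c)\<^sup>2 - 2 * Re c" for c
    unfolding cmod_power2 by (simp add: power2_eq_square algebra_simps)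
  have le: "(cmod (1 - c))\<^sup>2 \<le> 2 - 2 * Re c" if "cmod c \<le> 1" for c
    using sq[of c] that power_le_one[of "cmod c" 2] by simp
  have "cmod (1 - b) = cmod ((1 - a * b) - (1 - a) * b)" by (simp add: algebra_simps)
  also have "\<dots> \<le> cmod (1 - a * b) + cmod (1 - a)"
    using norm_triangle_ineq4[of "1 - a * b" "(1 - a) * b"] assms(2) by (simp add: norm_mult)
  finally have "(cmod (1 - b))\<^sup>2 \<le> (cmod (1 - a * b) + cmod (1 - a))\<^sup>2"
    by (rule power_mono) simp
  also have "\<dots> \<le> 2 * (cmod (1 - a * b))\<^sup>2 + 2 * (cmod (1 - a))\<^sup>2"
    using sum_squares_ge_zero[of "cmod (1 - a * b) - cmod (1 - a)" 0]
    by (simp add: power2_eq_square algebra_simps)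
  also have "\<dots> \<le> 2 * (2 - 2 * Re (a * b)) + 2 * (2 - 2 * Re a)"
    using le[of "a * b"] le[of a] assms by (intro add_mono mult_left_mono) (auto simp: norm_mult)
  finally show ?thesis using sq[of b] assms(2) by simp
qed

lemma norm_eq_1_of_pd_state:
  assumes "\<xi> \<in> pd_states" and mult: "\<xi> (- x + x) = \<xi> (- x) * \<xi> x"
  shows "cmod (\<xi> x) = 1"
proof -
  have "\<xi> (- x) * \<xi> x = 1" using mult assms(1) by (simp add: pd_states_def)
  then have "cmod (\<xi> (- x)) * cmod (\<xi> x) = 1" by (metis norm_mult norm_one)
  moreover have "cmod (\<xi> (- x)) = cmod (\<xi> x)"
    using assms(1) by (simp add: pd_states_def pos_def_uminus)
  ultimately have "(cmod (\<xi> x))\<^sup>2 = 1\<^sup>2" by (simp add: power2_eq_square)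
  then show ?thesis by (rule power2_eq_imp_eq) auto
qed

text \<open>With the autocorrelation \<open>\<phi>\<close> of \<open>R\<close>, normalised by \<open>\<phi> 0 = 1\<close>, the functional
  \<open>- Re (\<xi> z) + 24 (average of Re \<xi> over S)\<close> is at least \<open>24 (1 - 1/96) = 24 - 1/4\<close> at \<open>\<phi>\<close>. At a
  multiplicative maximiser \<open>\<xi>\<close> with loss \<open>1/4\<close> it is at least \<open>24 - 1/2\<close>. This forces \<open>Re (\<xi> z) \<le> 1/2\<close>
  and bounds the average of \<open>1 - Re \<xi>\<close> over \<open>S\<close> by \<open>1/16\<close>. The latter is an estimate in the mean only, but
  an element \<open>x\<close> that maps half of \<open>S\<close> into \<open>S\<close> is a difference of many pairs of elements of \<open>S\<close>, which
  yields \<open>1 - Re (\<xi> x) \<le> 8/16\<close>.\<close>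

lemma almost_character:
  fixes z :: "'g::ab_group_add"
  assumes R: "finite R" "R \<noteq> {}" and z: "\<And>r. r \<in> R \<Longrightarrow> r + z \<notin> R"
    and RS: "\<And>x. x \<in> S \<Longrightarrow> real (card {r \<in> R. r + x \<notin> R}) \<le> 1/96 * real (card R)"
    and S: "finite S" "S \<noteq> {}"
    and SF: "\<And>x. x \<in> F \<Longrightarrow> x \<in> W \<Longrightarrow> real (card {r \<in> S. r + x \<notin> S}) \<le> 1/2 * real (card S)"
    and F: "finite F"
  obtains \<xi> where "\<xi> \<in> pd_states" "\<And>x y. y \<in> F \<Longrightarrow> \<xi> (x + y) = \<xi> x * \<xi> y"
    "Re (\<xi> z) \<le> 1 / 2" "\<And>x. x \<in> F \<Longrightarrow> x \<in> W \<Longrightarrow> 1 / 2 \<le> Re (\<xi> x)"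
proof -
  define \<phi> :: "'g \<Rightarrow> complex" where
    "\<phi> x = complex_of_real (1 / card R) * of_nat (card {r \<in> R. r + x \<in> R})" for x
  have cR: "0 < card R" and cS: "0 < card S" using R S by (auto simp: card_gt_0_iff)
  have "pos_def \<phi>"
    unfolding \<phi>_def by (rule pos_def_scale[OF pos_def_correlation[OF R(1)]]) simp
  moreover have "\<phi> 0 = 1" using cR by (simp add: \<phi>_def)
  ultimately have \<phi>: "\<phi> \<in> pd_states" by (simp add: pd_states_def)
  have "{r \<in> R. r + z \<in> R} = {}" using z by auto
  then have \<phi>z: "\<phi> z = 0" by (simp only: \<phi>_def) simp
  have card_split: "real (card {r \<in> Q. r + x \<in> Q}) = real (card Q) - real (card {r \<in> Q. r + x \<notin> Q})"
    if "finite Q" for Q :: "'g set" and x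
  proof -
    have "card Q = card ({r \<in> Q. r + x \<in> Q} \<union> {r \<in> Q. r + x \<notin> Q})"
      by (rule arg_cong[where f = card]) auto
    also have "\<dots> = card {r \<in> Q. r + x \<in> Q} + card {r \<in> Q. r + x \<notin> Q}"
      using that by (intro card_Un_disjoint) auto
    finally show ?thesis by simp
  qed
  have \<phi>S: "95 / 96 \<le> Re (\<phi> x)" if "x \<in> S" for x
    using RS[OF that] cR card_split[OF R(1), of x] by (simp add: \<phi>_def field_simps)
  \<comment> \<open>Written as a sum because \<open>z\<close> may belong to \<open>S\<close>.\<close>
  define w where "w x = (if x = z then -1 else 0) + (if x \<in> S then 24 / real (card S) else 0)" for x
  have w: "(\<Sum>x\<in>insert z S. w x * g x) = - g z + 24 / real (card S) * (\<Sum>x\<in>S. g x)" for g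
  proof -
    have "(\<Sum>x\<in>insert z S. w x * g x) = (\<Sum>x\<in>insert z S. (if x = z then - g x else 0)) +
        (\<Sum>x\<in>insert z S. (if x \<in> S then 24 / real (card S) * g x else 0))"
      unfolding w_def sum.distrib[symmetric] by (rule sum.cong) (auto simp: algebra_simps)
    also have "(\<Sum>x\<in>insert z S. (if x = z then - g x else 0)) = - g z"
      using S(1) by (simp add: sum.delta)
    also have "(\<Sum>x\<in>insert z S. (if x \<in> S then 24 / real (card S) * g x else 0)) =
        (\<Sum>x\<in>S. 24 / real (card S) * g x)"
      by (rule sum.mono_neutral_cong_right) (use S(1) in auto)
    finally show ?thesis by (simp add: sum_distrib_left)
  qed
  \<comment> \<open>The negatives are included to get \<open>|\<xi> x| = 1\<close> from \<open>\<xi> (- x) \<xi> x = \<xi> 0\<close>.\<close>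
  have finF: "finite (F \<union> uminus ` F)" using F by simp
  obtain \<xi> where \<xi>: "\<xi> \<in> pd_states"
    and mult: "\<And>x y. y \<in> F \<union> uminus ` F \<Longrightarrow> \<xi> (x + y) = \<xi> x * \<xi> y"
    and max: "(\<Sum>x\<in>insert z S. w x * Re (\<phi> x)) - 1 / 4 \<le> (\<Sum>x\<in>insert z S. w x * Re (\<xi> x))"
    by (rule multiplicative_maximizer[OF finF \<phi>, where \<delta> = "1 / 4" and S = "insert z S" and w = w]) auto
  have le1: "cmod (\<xi> x) \<le> 1" for x by (rule pd_states_norm_le_1[OF \<xi>])
  have Re_le1: "Re (\<xi> x) \<le> 1" "- 1 \<le> Re (\<xi> x)" for x
    using le1[of x] abs_Re_le_cmod[of "\<xi> x"] by linarith+
  define D where "D = (\<Sum>x\<in>S. 1 - Re (\<xi> x))"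
  have D0: "0 \<le> D" unfolding D_def by (intro sum_nonneg) (simp add: Re_le1)
  have SD: "(\<Sum>x\<in>S. Re (\<xi> x)) = real (card S) - D" by (simp add: D_def sum_subtractf)
  have "(\<Sum>x\<in>S. 95 / 96) \<le> (\<Sum>x\<in>S. Re (\<phi> x))" by (intro sum_mono \<phi>S)
  then have "24 / real (card S) * (95 / 96 * real (card S)) \<le> 24 / real (card S) * (\<Sum>x\<in>S. Re (\<phi> x))"
    by (intro mult_left_mono) auto
  moreover have "24 / real (card S) * (95 / 96 * real (card S)) = 95 / 4" using cS by simp
  moreover have "- Re 0 + 24 / real (card S) * (\<Sum>x\<in>S. Re (\<phi> x)) - 1 / 4
      \<le> - Re (\<xi> z) + 24 / real (card S) * (real (card S) - D)"
    using max unfolding w \<phi>z SD .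
  moreover have "Re 0 = 0" by simp
  ultimately have "95 / 4 - 1 / 4 \<le> - Re (\<xi> z) + 24 / real (card S) * (real (card S) - D)"
    by linarith
  then have *: "24 * D / real (card S) \<le> 1 / 2 - Re (\<xi> z)" using cS by (simp add: field_simps)
  show thesis
  proof (rule that[OF \<xi>])
    show "\<xi> (x + y) = \<xi> x * \<xi> y" if "y \<in> F" for x y using mult that by blast
    show "Re (\<xi> z) \<le> 1 / 2"
      using * D0 cS by (smt (verit) divide_nonneg_pos of_nat_0_less_iff mult_nonneg_nonneg)
    fix x assume x: "x \<in> F" "x \<in> W"
    have norm1: "cmod (\<xi> x) = 1"
      by (rule norm_eq_1_of_pd_state[OF \<xi>]) (rule mult, use x(1) in blast)
    define S' where "S' = {r \<in> S. r + x \<in> S}"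
    have S': "real (card S) / 2 \<le> real (card S')"
      using SF[OF x] card_split[OF S(1), of x] by (simp add: S'_def)
    have finS': "finite S'" using S(1) by (simp add: S'_def)
    have "real (card S) / 2 * (1 - Re (\<xi> x)) \<le> real (card S') * (1 - Re (\<xi> x))"
      using S' Re_le1(1)[of x] by (intro mult_right_mono) auto
    also have "\<dots> = (\<Sum>r\<in>S'. 1 - Re (\<xi> x))" by simp
    also have "\<dots> \<le> (\<Sum>r\<in>S'. 2 * (1 - Re (\<xi> r)) + 2 * (1 - Re (\<xi> (r + x))))"
      using one_minus_Re_quotient_le[OF le1 norm1] mult x(1) by (intro sum_mono) auto
    also have "\<dots> = 2 * (\<Sum>r\<in>S'. 1 - Re (\<xi> r)) + 2 * (\<Sum>r\<in>S'. 1 - Re (\<xi> (r + x)))"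
      by (simp only: sum.distrib sum_distrib_left)
    also have "(\<Sum>r\<in>S'. 1 - Re (\<xi> (r + x))) = (\<Sum>r\<in>(\<lambda>r. r + x) ` S'. 1 - Re (\<xi> r))"
      by (subst sum.reindex) (auto simp: inj_on_def)
    also have "2 * (\<Sum>r\<in>S'. 1 - Re (\<xi> r)) + 2 * (\<Sum>r\<in>(\<lambda>r. r + x) ` S'. 1 - Re (\<xi> r)) \<le> 2 * D + 2 * D"
      unfolding D_def
      by (intro add_mono mult_left_mono sum_mono2) (use S(1) Re_le1 in \<open>auto simp: S'_def\<close>)
    finally have "1 - Re (\<xi> x) \<le> 8 * D / real (card S)" using cS by (simp add: field_simps)
    also have "\<dots> \<le> 1 / 2" using * Re_le1(2)[of z] by simp
    finally show "1 / 2 \<le> Re (\<xi> x)" by simp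
  qed
qed

text \<open>All requirements on \<open>\<xi>\<close> are closed conditions on finitely many of its values, so that compactness
  makes it possible to meet them simultaneously.\<close>

lemma homomorphism_from_finite_stages:
  fixes z :: "'g::ab_group_add"
  assumes stage: "\<And>F. finite F \<Longrightarrow> \<exists>\<xi>\<in>pd_states. (\<forall>x. \<forall>y\<in>F. \<xi> (x + y) = \<xi> x * \<xi> y) \<and>
      Re (\<xi> z) \<le> 1 / 2 \<and> (\<forall>x\<in>F \<inter> W. 1 / 2 \<le> Re (\<xi> x))"
  obtains \<xi> :: "'g \<Rightarrow> complex" where "\<And>x y. \<xi> (x + y) = \<xi> x * \<xi> y" "\<And>x. cmod (\<xi> x) = 1"
    "Re (\<xi> z) \<le> 1 / 2" "\<And>x. x \<in> W \<Longrightarrow> 1 / 2 \<le> Re (\<xi> x)"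
proof -
  define X where "X F = {\<xi>. (\<forall>x. \<forall>y\<in>F. \<xi> (x + y) = \<xi> x * \<xi> y) \<and>
      Re (\<xi> z) \<le> 1 / 2 \<and> (\<forall>x\<in>F \<inter> W. 1 / 2 \<le> Re (\<xi> x))}" for F :: "'g set"
  have closed: "closed (X F)" for F
    unfolding X_def Ball_def
    by (intro closed_Collect_conj closed_Collect_all closed_Collect_imp closed_Collect_eq
        closed_Collect_le continuous_intros continuous_on_product_coordinates) auto
  have "pd_states \<inter> (\<Inter>F\<in>{F. finite F}. X F) \<noteq> {}"
  proof (rule compact_imp_fip_image[OF compact_pd_states])
    show "closed (X F)" for F by (rule closed)
    fix I' :: "'g set set" assume I': "finite I'" "I' \<subseteq> {F. finite F}"
    then have "finite (\<Union>I')" by auto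
    from stage[OF this] obtain \<xi> where "\<xi> \<in> pd_states" "\<xi> \<in> X (\<Union>I')"
      unfolding X_def mem_Collect_eq by (elim bexE)
    moreover have "X F' \<subseteq> X F" if "F \<subseteq> F'" for F F'
      using that by (auto simp: X_def)
    then have "X (\<Union>I') \<subseteq> (\<Inter>F\<in>I'. X F)" by (intro INT_greatest) (simp add: Union_upper)
    ultimately show "pd_states \<inter> (\<Inter>F\<in>I'. X F) \<noteq> {}" by auto
  qed
  then obtain \<xi> where \<xi>: "\<xi> \<in> pd_states" and X: "\<And>F. finite F \<Longrightarrow> \<xi> \<in> X F" by blast
  have mult: "\<xi> (x + y) = \<xi> x * \<xi> y" for x y
    using X[of "{y}"] unfolding X_def by simp
  show thesis
  proof (rule that[of \<xi>])
    show "\<xi> (x + y) = \<xi> x * \<xi> y" for x y by (rule mult)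
    show "Re (\<xi> z) \<le> 1 / 2" using X[of "{}"] by (simp add: X_def)
    show "1 / 2 \<le> Re (\<xi> x)" if "x \<in> W" for x using X[of "{x}"] that by (simp add: X_def)
    show "cmod (\<xi> x) = 1" for x using \<xi> by (rule norm_eq_1_of_pd_state) (rule mult)
  qed
qed

section \<open>Characters of a locally compact abelian group modulo a closed subgroup\<close>

text \<open>The preimages in \<open>G\<close> of neighbourhoods of \<open>0\<close> in \<open>G / H\<close>, and larger sets. They make it possible to argue about \<open>G / H\<close>
  without forming the quotient.\<close>

definition saturated_nhd :: "'g::topological_ab_group_add set \<Rightarrow> 'g set \<Rightarrow> bool" where
  "saturated_nhd H V \<longleftrightarrow> (\<exists>U. open U \<and> 0 \<in> U \<and> (\<forall>u\<in>U. \<forall>h\<in>H. u + h \<in> V))"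

lemma subgroup_subset_saturated_nhd: "saturated_nhd H V \<Longrightarrow> H \<subseteq> V"
  unfolding saturated_nhd_def by (metis add_0 subsetI)

lemma zero_in_saturated_nhd: "add_subgroup H \<Longrightarrow> saturated_nhd H V \<Longrightarrow> 0 \<in> V"
  using subgroup_subset_saturated_nhd by (auto simp: add_subgroup_def)

lemma saturated_nhd_Int:
  assumes "saturated_nhd H V" "saturated_nhd H V'"
  shows "saturated_nhd H (V \<inter> V')"
proof -
  obtain U U' where "open U" "0 \<in> U" "\<forall>u\<in>U. \<forall>h\<in>H. u + h \<in> V"
    "open U'" "0 \<in> U'" "\<forall>u\<in>U'. \<forall>h\<in>H. u + h \<in> V'"
    using assms unfolding saturated_nhd_def by blast
  then show ?thesis
    unfolding saturated_nhd_def by (intro exI[of _ "U \<inter> U'"]) auto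
qed

lemma open_add_nhd:
  fixes x y :: "'g::topological_ab_group_add"
  assumes "open U" "x + y \<in> U"
  obtains X Y where "open X" "x \<in> X" "open Y" "y \<in> Y" "\<And>u v. u \<in> X \<Longrightarrow> v \<in> Y \<Longrightarrow> u + v \<in> U"
proof -
  have "eventually (\<lambda>w. w \<in> U) (nhds (x + y))" using assms by (auto simp: eventually_nhds)
  then have "\<forall>\<^sub>F p in nhds x \<times>\<^sub>F nhds y. fst p + snd p \<in> U"
    using tendsto_add_Pair[of x y] unfolding filterlim_iff by blast
  then obtain P Q where "eventually P (nhds x)" "eventually Q (nhds y)"
    "\<And>u v. P u \<Longrightarrow> Q v \<Longrightarrow> u + v \<in> U"
    unfolding eventually_prod_filter by auto
  then show thesis using that unfolding eventually_nhds by (metis (full_types))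
qed

lemma saturated_nhd_halve:
  assumes "add_subgroup H" "saturated_nhd H V"
  obtains W where "saturated_nhd H W" "\<And>x y. x \<in> W \<Longrightarrow> y \<in> W \<Longrightarrow> x + y \<in> V"
proof -
  obtain U where U: "open U" "0 \<in> U" "\<And>u h. u \<in> U \<Longrightarrow> h \<in> H \<Longrightarrow> u + h \<in> V"
    using assms(2) unfolding saturated_nhd_def by blast
  obtain X Y where XY: "open X" "0 \<in> X" "open Y" "0 \<in> Y" "\<And>u v. u \<in> X \<Longrightarrow> v \<in> Y \<Longrightarrow> u + v \<in> U"
    using open_add_nhd[of U 0 0] U by auto
  define W where "W = {u + h | u h. u \<in> X \<inter> Y \<and> h \<in> H}"
  show thesis
  proof (rule that[of W])
    show "saturated_nhd H W"
      unfolding saturated_nhd_def W_def using XY by (intro exI[of _ "X \<inter> Y"]) auto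
    fix x y assume "x \<in> W" "y \<in> W"
    then obtain u h u' h' where "u \<in> X" "u' \<in> Y" "h \<in> H" "h' \<in> H" "x = u + h" "y = u' + h'"
      unfolding W_def by blast
    moreover from this have "(u + u') + (h + h') \<in> V"
      using U(3) XY(5) assms(1) by (auto simp: add_subgroup_def)
    ultimately show "x + y \<in> V" by (simp add: ac_simps)
  qed
qed

primrec iterated_sumset :: "nat \<Rightarrow> 'g::ab_group_add set \<Rightarrow> 'g set" where
  "iterated_sumset 0 W = {0}"
| "iterated_sumset (Suc n) W = {x + w | x w. x \<in> iterated_sumset n W \<and> w \<in> W}"

lemma iterated_sumset_mono: "W \<subseteq> W' \<Longrightarrow> iterated_sumset n W \<subseteq> iterated_sumset n W'"
  by (induction n) auto

lemma saturated_nhd_iterated: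
  assumes H: "add_subgroup H" and "saturated_nhd H V"
  shows "\<exists>W. saturated_nhd H W \<and> iterated_sumset n W \<subseteq> V"
  using assms(2)
proof (induction n arbitrary: V)
  case 0
  then show ?case using zero_in_saturated_nhd[OF H] by (intro exI[of _ V]) auto
next
  case (Suc n)
  obtain V' where V': "saturated_nhd H V'" "\<And>x y. x \<in> V' \<Longrightarrow> y \<in> V' \<Longrightarrow> x + y \<in> V"
    using saturated_nhd_halve[OF H Suc.prems] by blast
  obtain W where W: "saturated_nhd H W" "iterated_sumset n W \<subseteq> V'" using Suc.IH[OF V'(1)] by blast
  have "iterated_sumset (Suc n) (W \<inter> V') \<subseteq> V"
    using W(2) V'(2) iterated_sumset_mono[of "W \<inter> V'" W n] by fastforce
  then show ?case using saturated_nhd_Int[OF W(1) V'(1)] by blast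
qed

text \<open>Total boundedness of the image of \<open>B\<close> in \<open>G / H\<close>.\<close>

definition precompact_mod :: "'g::topological_ab_group_add set \<Rightarrow> 'g set \<Rightarrow> bool" where
  "precompact_mod H B \<longleftrightarrow>
     (\<forall>A. saturated_nhd H A \<longrightarrow> (\<exists>C. finite C \<and> B \<subseteq> (\<Union>c\<in>C. (\<lambda>a. a + c) ` A)))"

lemma precompact_mod_subset: "precompact_mod H B \<Longrightarrow> B' \<subseteq> B \<Longrightarrow> precompact_mod H B'"
  unfolding precompact_mod_def by (meson order_trans)

lemma open_translate:
  fixes U :: "'g::topological_ab_group_add set"
  assumes "open U"
  shows "open ((\<lambda>a. a + c) ` U)"
proof -
  have "(\<lambda>a. a + c) ` U = (\<lambda>x. x + - c) -` U"
    by (auto simp: image_iff) (metis diff_add_cancel)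
  moreover have "open ((\<lambda>x. x + - c) -` U)"
    by (rule open_vimage[OF assms]) (intro continuous_intros)
  ultimately show ?thesis by simp
qed

lemma exists_precompact_saturated_nhd:
  fixes H :: "'g::topological_ab_group_add set"
  assumes "locally_compact_space (euclidean :: 'g topology)"
  obtains B where "saturated_nhd H B" "precompact_mod H B"
proof -
  obtain U K where UK: "open U" "compact K" "(0::'g) \<in> U" "U \<subseteq> K"
    using assms unfolding locally_compact_space_def by (auto dest: spec[of _ 0])
  define B where "B = {u + h | u h. u \<in> U \<and> h \<in> H}"
  show thesis
  proof (rule that[of B])
    show "saturated_nhd H B"
      unfolding saturated_nhd_def B_def using UK by (intro exI[of _ U]) auto
    show "precompact_mod H B"
      unfolding precompact_mod_def
    proof (intro allI impI)
      fix A assume "saturated_nhd H A"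
      then obtain V where V: "open V" "0 \<in> V" "\<And>u h. u \<in> V \<Longrightarrow> h \<in> H \<Longrightarrow> u + h \<in> A"
        unfolding saturated_nhd_def by blast
      have "K \<subseteq> (\<Union>c\<in>K. (\<lambda>a. a + c) ` V)"
        using V(2) by (force intro: image_eqI[of _ _ 0])
      then obtain C where C: "C \<subseteq> K" "finite C" "K \<subseteq> (\<Union>c\<in>C. (\<lambda>a. a + c) ` V)"
        using compactE_image[OF UK(2), of K "\<lambda>c. (\<lambda>a. a + c) ` V"] open_translate[OF V(1)]
        by metis
      have "B \<subseteq> (\<Union>c\<in>C. (\<lambda>a. a + c) ` A)"
      proof
        fix b assume "b \<in> B"
        then obtain u h where b: "b = u + h" "u \<in> U" "h \<in> H" unfolding B_def by blast
        then obtain c v where c: "c \<in> C" "v \<in> V" "u = v + c" using C(3) UK(4) by blast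
        then have "b = (v + h) + c" using b by (simp add: ac_simps)
        with V(3)[OF c(2) b(3)] c(1) show "b \<in> (\<Union>c\<in>C. (\<lambda>a. a + c) ` A)" by blast
      qed
      with C(2) show "\<exists>C. finite C \<and> B \<subseteq> (\<Union>c\<in>C. (\<lambda>a. a + c) ` A)" by blast
    qed
  qed
qed

lemma saturated_nhd_separating:
  fixes H :: "'g::topological_ab_group_add set"
  assumes H: "add_subgroup H" "closed H" and z: "z \<notin> H"
  obtains V where "saturated_nhd H V" "\<And>x. x \<in> V \<Longrightarrow> x + z \<notin> V"
proof -
  obtain X Y where X: "open X" "z \<in> X" and Y: "open Y" "0 \<in> Y"
    and XY: "\<And>u v. u \<in> X \<Longrightarrow> v \<in> Y \<Longrightarrow> u + v \<in> - H"
    using open_add_nhd[of "- H" z 0] H(2) z by auto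
  obtain X' Z where X': "open X'" "0 \<in> X'" "open Z" "z \<in> Z"
    and XZ: "\<And>u v. u \<in> X' \<Longrightarrow> v \<in> Z \<Longrightarrow> u + v \<in> X"
    using open_add_nhd[of X 0 z] X by auto
  have "open (uminus -` Y)"
    by (rule open_vimage[OF Y(1)]) (simp add: continuous_on_def tendsto_minus tendsto_ident_at)
  then have U: "open (X' \<inter> uminus -` Y)" "0 \<in> X' \<inter> uminus -` Y" using X' Y by auto
  define V where "V = {u + h | u h. u \<in> X' \<inter> uminus -` Y \<and> h \<in> H}"
  show thesis
  proof (rule that[of V])
    show "saturated_nhd H V"
      unfolding saturated_nhd_def V_def using U by blast
    fix x assume "x \<in> V"
    then obtain u h where u: "u \<in> X'" "h \<in> H" "x = u + h" unfolding V_def by blast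
    show "x + z \<notin> V"
    proof
      assume "x + z \<in> V"
      then obtain v h' where v: "- v \<in> Y" "h' \<in> H" "x + z = v + h'" unfolding V_def by blast
      have "(u + z) + - v \<in> - H" using XY XZ u(1) X'(4) v(1) by blast
      moreover have "(u + z) + - v = h' - h" using u(3) v(3) by (simp add: algebra_simps)
      moreover have "h' - h \<in> H"
        using H(1) u(2) v(2) unfolding add_subgroup_def by (metis diff_conv_add_uminus)
      ultimately show False by simp
    qed
  qed
qed

text \<open>The neighbourhood \<open>W\<close> is chosen once and for all, before the finite set \<open>E\<close> and the almost invariant
  set \<open>R\<close>. It is so small that \<open>n\<close>-fold sums of its elements stay in a set \<open>A\<close> with \<open>A + A \<subseteq> V\<close>.\<close>

lemma Folner_sets_in_saturated_nhd:
  assumes H: "add_subgroup H" and V: "saturated_nhd H V" "precompact_mod H V" and \<epsilon>: "0 < \<epsilon>"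
  obtains W where "saturated_nhd H W"
    "\<And>E. finite E \<Longrightarrow> \<exists>R. finite R \<and> R \<noteq> {} \<and> R \<subseteq> V \<and>
       (\<forall>x\<in>E \<inter> W. real (card {r \<in> R. r + x \<notin> R}) \<le> \<epsilon> * real (card R))"
proof -
  obtain A where A: "saturated_nhd H A" "\<And>x y. x \<in> A \<Longrightarrow> y \<in> A \<Longrightarrow> x + y \<in> V"
    using saturated_nhd_halve[OF H V(1)] by blast
  obtain C where C: "finite C" "V \<subseteq> (\<Union>c\<in>C. (\<lambda>a. a + c) ` A)"
    using V(2) A(1) unfolding precompact_mod_def by blast
  obtain n where n: "2 * real (card C) < (1 + \<epsilon>) ^ n"
    using real_arch_pow[of "1 + \<epsilon>"] \<epsilon> by auto
  obtain W where W: "saturated_nhd H W" "iterated_sumset n W \<subseteq> A"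
    using saturated_nhd_iterated[OF H A(1)] by blast
  \<comment> \<open>The chain increases from \<open>A\<close> to a subset of \<open>A + A\<close>; the number of translates covering \<open>V\<close> was fixed before \<open>W\<close>.\<close>
  define B where "B k = {a + w | a w. a \<in> A \<and> w \<in> iterated_sumset k W}" for k
  have B0: "B 0 = A" by (auto simp: B_def)
  have Bn: "B n \<subseteq> V" using A(2) W(2) by (auto simp: B_def)
  show thesis
  proof (rule that[OF W(1)])
    fix E :: "'a set" assume E: "finite E"
    obtain R where "finite R" "R \<noteq> {}" "R \<subseteq> B n"
      "\<And>x. x \<in> E \<Longrightarrow> x \<in> W \<Longrightarrow> real (card {r \<in> R. r + x \<notin> R}) \<le> \<epsilon> * real (card R)"
    proof (rule relative_Folner_set[of B W n C \<epsilon> E])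
      show "0 \<in> B 0" "0 \<in> W" using zero_in_saturated_nhd[OF H] A(1) W(1) B0 by auto
      show "a + w \<in> B (Suc k)" if "a \<in> B k" "w \<in> W" for a w k
        using that unfolding B_def by (force simp: ac_simps)
      show "B n \<subseteq> (\<Union>c\<in>C. (\<lambda>a. a + c) ` B 0)" unfolding B0 using Bn C(2) by (rule order_trans)
    qed (use C(1) n \<epsilon> E in auto)
    with Bn show "\<exists>R. finite R \<and> R \<noteq> {} \<and> R \<subseteq> V \<and>
       (\<forall>x\<in>E \<inter> W. real (card {r \<in> R. r + x \<notin> R}) \<le> \<epsilon> * real (card R))"
      by (intro exI[of _ R]) auto
  qed
qed

text \<open>The Gelfand-Raikov theorem for the group \<open>G / H\<close>. The almost invariant sets are used twice: \<open>R\<close>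
  lies in a neighbourhood \<open>V\<close> that does not meet \<open>V + z\<close>, which makes its autocorrelation vanish at \<open>z\<close>;
  it is almost invariant under elements of \<open>W1\<close>, and \<open>S\<close> is a subset of \<open>W1\<close> that spreads the information
  in the mean to the single elements of a smaller neighbourhood \<open>W\<close>.

  The homomorphism found in this way is trivial on \<open>H\<close> and continuous because
  \<open>|\<xi>(x) - 1| \<le> (2/3) |\<xi>(2 x) - 1|\<close> for \<open>x \<in> W\<close>: the deviation from \<open>1\<close> shrinks by a fixed factor
  each time the neighbourhood is halved.\<close>

lemma annihilator_separates_points:
  fixes H :: "'g::topological_ab_group_add set"
  assumes lc: "locally_compact_space (euclidean :: 'g topology)"
    and H: "add_subgroup H" "closed H" and z: "z \<notin> H"
  obtains \<gamma> where "\<gamma> \<in> annihilator H" "\<langle>\<gamma>, z\<rangle> \<noteq> 1"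
proof -
  obtain B where B: "saturated_nhd H B" "precompact_mod H B"
    using exists_precompact_saturated_nhd[OF lc] by blast
  obtain V where V: "saturated_nhd H V" "\<And>x. x \<in> V \<Longrightarrow> x + z \<notin> V"
    using saturated_nhd_separating[OF H z] by blast
  obtain W1 where W1: "saturated_nhd H W1"
    and R: "\<And>E. finite E \<Longrightarrow> \<exists>R. finite R \<and> R \<noteq> {} \<and> R \<subseteq> V \<inter> B \<and>
       (\<forall>x\<in>E \<inter> W1. real (card {r \<in> R. r + x \<notin> R}) \<le> 1/96 * real (card R))"
    by (rule Folner_sets_in_saturated_nhd[OF H(1) saturated_nhd_Int[OF V(1) B(1)]
          precompact_mod_subset[OF B(2)], of "1/96"]) auto
  obtain W where W: "saturated_nhd H W"
    and S: "\<And>E. finite E \<Longrightarrow> \<exists>R. finite R \<and> R \<noteq> {} \<and> R \<subseteq> W1 \<inter> B \<and>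
       (\<forall>x\<in>E \<inter> W. real (card {r \<in> R. r + x \<notin> R}) \<le> 1/2 * real (card R))"
    by (rule Folner_sets_in_saturated_nhd[OF H(1) saturated_nhd_Int[OF W1 B(1)]
          precompact_mod_subset[OF B(2)], of "1/2"]) auto
  obtain \<xi> where mult: "\<And>x y. \<xi> (x + y) = \<xi> x * \<xi> y" and norm: "\<And>x. cmod (\<xi> x) = 1"
    and \<xi>z: "Re (\<xi> z) \<le> 1 / 2" and \<xi>W: "\<And>x. x \<in> W \<Longrightarrow> 1 / 2 \<le> Re (\<xi> x)"
  proof (rule homomorphism_from_finite_stages[of z W])
    fix F :: "'g set" assume F: "finite F"
    obtain S where S: "finite S" "S \<noteq> {}" "S \<subseteq> W1 \<inter> B"
      "\<And>x. x \<in> F \<Longrightarrow> x \<in> W \<Longrightarrow> real (card {r \<in> S. r + x \<notin> S}) \<le> 1/2 * real (card S)"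
      using S[OF F] by blast
    obtain R where R: "finite R" "R \<noteq> {}" "R \<subseteq> V \<inter> B"
      "\<And>x. x \<in> S \<Longrightarrow> real (card {r \<in> R. r + x \<notin> R}) \<le> 1/96 * real (card R)"
      using R[OF S(1)] S(3) by blast
    show "\<exists>\<xi>\<in>pd_states. (\<forall>x. \<forall>y\<in>F. \<xi> (x + y) = \<xi> x * \<xi> y) \<and>
      Re (\<xi> z) \<le> 1 / 2 \<and> (\<forall>x\<in>F \<inter> W. 1 / 2 \<le> Re (\<xi> x))"
    proof (rule almost_character[OF R(1,2) _ R(4) S(1,2,4) F])
      show "r + z \<notin> R" if "r \<in> R" for r using that R(3) V(2) by blast
    qed blast+
  qed blast
  have small: "\<exists>W'. saturated_nhd H W' \<and> (\<forall>x\<in>W'. cmod (\<xi> x - 1) \<le> 2 * (2 / 3) ^ m)" for m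
  proof (induction m)
    case 0
    have "cmod (\<xi> x - 1) \<le> 2" for x
      using norm_triangle_ineq4[of "\<xi> x" 1] norm[of x] by simp
    then show ?case using W by auto
  next
    case (Suc m)
    then obtain W' where W': "saturated_nhd H W'" "\<And>x. x \<in> W' \<Longrightarrow> cmod (\<xi> x - 1) \<le> 2 * (2 / 3) ^ m"
      by blast
    obtain W'' where W'': "saturated_nhd H W''" "\<And>x y. x \<in> W'' \<Longrightarrow> y \<in> W'' \<Longrightarrow> x + y \<in> W'"
      using saturated_nhd_halve[OF H(1) W'(1)] by blast
    have "cmod (\<xi> x - 1) \<le> 2 * (2 / 3) ^ Suc m" if x: "x \<in> W'' \<inter> W" for x
    proof -
      have "3 / 2 \<le> Re (\<xi> x + 1)" using \<xi>W[of x] x by simp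
      also have "\<dots> \<le> cmod (\<xi> x + 1)" by (rule complex_Re_le_cmod)
      finally have "cmod (\<xi> x - 1) * (3 / 2) \<le> cmod (\<xi> x - 1) * cmod (\<xi> x + 1)"
        by (rule mult_left_mono) simp
      also have "\<dots> = cmod (\<xi> (x + x) - 1)"
        by (simp add: mult norm_mult[symmetric] algebra_simps)
      also have "\<dots> \<le> 2 * (2 / 3) ^ m" using W' W'' x by blast
      finally show ?thesis by simp
    qed
    then show ?case using saturated_nhd_Int[OF W''(1) W] by blast
  qed
  have small': "\<exists>W'. saturated_nhd H W' \<and> (\<forall>x\<in>W'. cmod (\<xi> x - 1) < e)" if e: "0 < e" for e
  proof -
    obtain m where "(2 / 3 :: real) ^ m < e / 2" using real_arch_pow_inv[of "e / 2" "2 / 3"] e by auto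
    then have "2 * (2 / 3 :: real) ^ m < e" by simp
    then show ?thesis using small[of m] by (meson le_less_trans)
  qed
  \<comment> \<open>The set \<open>H\<close> is contained in each of these neighbourhoods, however close to \<open>1\<close> the values of \<open>\<xi>\<close> are there.\<close>
  have trivial: "\<xi> h = 1" if "h \<in> H" for h
  proof (rule ccontr)
    assume "\<xi> h \<noteq> 1"
    then obtain W' where "saturated_nhd H W'" "\<forall>x\<in>W'. cmod (\<xi> x - 1) < cmod (\<xi> h - 1)"
      using small'[of "cmod (\<xi> h - 1)"] by auto
    then show False using subgroup_subset_saturated_nhd that by blast
  qed
  have cont: "continuous_on UNIV \<xi>"
    unfolding continuous_on_def tendsto_iff
  proof (intro ballI allI impI)
    fix e :: real and y :: 'g
    assume "0 < e"
    then obtain W' where W': "saturated_nhd H W'" "\<And>x. x \<in> W' \<Longrightarrow> cmod (\<xi> x - 1) < e"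
      using small' by blast
    then obtain U where U: "open U" "0 \<in> U" "\<And>u h. u \<in> U \<Longrightarrow> h \<in> H \<Longrightarrow> u + h \<in> W'"
      unfolding saturated_nhd_def by blast
    have U': "u \<in> W'" if "u \<in> U" for u
      using U(3)[OF that, of 0] H(1) by (simp add: add_subgroup_def)
    have "\<forall>v\<in>(\<lambda>a. a + y) ` U. dist (\<xi> v) (\<xi> y) < e"
    proof
      fix v assume "v \<in> (\<lambda>a. a + y) ` U"
      then obtain u where u: "u \<in> U" "v = u + y" by blast
      then have "\<xi> v - \<xi> y = (\<xi> u - 1) * \<xi> y" by (simp add: mult algebra_simps)
      then show "dist (\<xi> v) (\<xi> y) < e"
        using W'(2)[OF U'[OF u(1)]] norm[of y] by (simp add: dist_norm norm_mult)
    qed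
    moreover have "y \<in> (\<lambda>a. a + y) ` U" using U(2) by (intro image_eqI[of _ _ 0]) auto
    ultimately have "\<forall>\<^sub>F v in nhds y. dist (\<xi> v) (\<xi> y) < e"
      unfolding eventually_nhds using open_translate[OF U(1)] by blast
    then show "\<forall>\<^sub>F v in at y. dist (\<xi> v) (\<xi> y) < e"
      unfolding eventually_at_filter by (rule eventually_mono) simp
  qed
  have pairing: "\<langle>Abs_dual \<xi>, x\<rangle> = \<xi> x" for x
    using cont mult norm by (subst Abs_dual_inverse) auto
  show thesis
  proof (rule that[of "Abs_dual \<xi>"])
    show "Abs_dual \<xi> \<in> annihilator H" using trivial by (simp add: annihilator_def pairing)
    show "\<langle>Abs_dual \<xi>, z\<rangle> \<noteq> 1" using \<xi>z by (auto simp: pairing)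
  qed
qed

section \<open>Uniqueness of Fourier-Stieltjes transforms\<close>

lemma finite_regular_borelD:
  assumes "finite_regular_borel \<mu>"
  shows "finite_measure \<mu>" "sets \<mu> = sets borel" "space \<mu> = UNIV"
  using assms sets_eq_imp_space_eq[of \<mu> borel] by (auto simp: finite_regular_borel_def)

lemma finite_regular_borel_approx:
  assumes "finite_regular_borel \<mu>" "B \<in> sets borel" "0 < \<epsilon>"
  obtains K U where "compact K" "open U" "K \<subseteq> B" "B \<subseteq> U" "measure \<mu> (U - K) < \<epsilon>"
  using assms unfolding finite_regular_borel_def by blast

lemma compose_real_polynomial:
  fixes q :: "real \<Rightarrow> real"
  assumes "real_polynomial_function q"
    and const: "\<And>c. (\<lambda>_. c) \<in> R"
    and add: "\<And>f g. f \<in> R \<Longrightarrow> g \<in> R \<Longrightarrow> (\<lambda>x. f x + g x) \<in> R"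
    and mult: "\<And>f g. f \<in> R \<Longrightarrow> g \<in> R \<Longrightarrow> (\<lambda>x. f x * g x) \<in> R"
    and p: "p \<in> R"
  shows "(\<lambda>x. q (p x)) \<in> R"
  using assms(1)
proof induction
  case (linear f)
  then obtain c where "f = (\<lambda>x. x * c)" unfolding real_bounded_linear by blast
  then show ?case using mult[OF p const] by simp
qed (use const add mult in auto)

text \<open>By the Stone-Weierstrass theorem there is \<open>p\<close> in the algebra \<open>R\<close> that is close to \<open>1\<close> on \<open>K\<close> and close
  to \<open>0\<close> on \<open>L - U\<close>, where \<open>L\<close> is compact and carries almost all of the mass of \<open>\<rho>\<close> and \<open>U\<close> is open and
  contains little more of this mass than \<open>K\<close>. The values of \<open>p\<close> off \<open>L\<close> are out of control, but \<open>p\<close> is bounded, so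
  that a polynomial \<open>q\<close> approximating \<open>t \<mapsto> max 0 (min 1 t)\<close> on the range of \<open>p\<close> turns it into
  \<open>q \<circ> p\<close>, which is in \<open>R\<close> as well and has values close to \<open>[0, 1]\<close> everywhere.\<close>

lemma measure_compact_le_of_integrals_eq:
  fixes \<mu> \<rho> :: "'a::t2_space measure" and R :: "('a \<Rightarrow> real) set"
  assumes \<mu>: "finite_regular_borel \<mu>" and \<rho>: "finite_regular_borel \<rho>"
    and const: "\<And>c. (\<lambda>_. c) \<in> R"
    and add: "\<And>f g. f \<in> R \<Longrightarrow> g \<in> R \<Longrightarrow> (\<lambda>x. f x + g x) \<in> R"
    and mult: "\<And>f g. f \<in> R \<Longrightarrow> g \<in> R \<Longrightarrow> (\<lambda>x. f x * g x) \<in> R"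
    and cont: "\<And>f. f \<in> R \<Longrightarrow> continuous_on UNIV f"
    and bdd: "\<And>f. f \<in> R \<Longrightarrow> \<exists>C. \<forall>x. \<bar>f x\<bar> \<le> C"
    and sep: "\<And>x y. x \<noteq> y \<Longrightarrow> \<exists>f\<in>R. f x \<noteq> f y"
    and eq: "\<And>f. f \<in> R \<Longrightarrow> (\<integral>x. f x \<partial>\<mu>) = (\<integral>x. f x \<partial>\<rho>)"
    and K: "compact K"
  shows "measure \<mu> K \<le> measure \<rho> K"
proof -
  interpret \<mu>: finite_measure \<mu> using \<mu> by (rule finite_regular_borelD)
  interpret \<rho>: finite_measure \<rho> using \<rho> by (rule finite_regular_borelD)
  have sets [measurable_cong]: "sets \<mu> = sets borel" "sets \<rho> = sets borel"
    and space: "space \<mu> = UNIV" "space \<rho> = UNIV"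
    using \<mu> \<rho> by (auto dest: finite_regular_borelD)
  have K_borel: "K \<in> sets borel" using K by (rule borel_compact)
  have bound: "measure \<mu> K \<le> measure \<rho> K + \<epsilon> * (2 + 2 * measure \<mu> UNIV + 2 * measure \<rho> UNIV)"
    if \<epsilon>: "0 < \<epsilon>" "\<epsilon> < 1" for \<epsilon>
  proof -
    obtain K1 U1 where K1: "compact K1" "UNIV \<subseteq> U1" "measure \<rho> (U1 - K1) < \<epsilon>"
      using finite_regular_borel_approx[OF \<rho> _ \<epsilon>(1), of UNIV] by (metis sets.top space_borel)
    obtain K2 U where U: "open U" "K \<subseteq> U" "K2 \<subseteq> K" "measure \<rho> (U - K2) < \<epsilon>" "compact K2"
      using finite_regular_borel_approx[OF \<rho> K_borel \<epsilon>(1)] by metis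
    have U_borel: "U \<in> sets borel" using U(1) by simp
    have "U - K \<subseteq> U - K2" using U(3) by blast
    then have UK: "measure \<rho> (U - K) < \<epsilon>"
      using \<rho>.finite_measure_mono[of "U - K" "U - K2"] U(4) U_borel borel_compact[OF U(5)] sets
      by fastforce
    define L where "L = K \<union> K1"
    have L: "compact L" using K K1(1) by (simp add: L_def compact_Un)
    have L_borel: "L \<in> sets borel" using L by (rule borel_compact)
    have "- L \<subseteq> U1 - K1" using K1(2) by (auto simp: L_def)
    then have rho_L: "measure \<rho> (- L) < \<epsilon>"
      using \<rho>.finite_measure_mono[of "- L" "U1 - K1"] K1 L_borel borel_compact[OF K1(1)] sets
      by (simp add: top.extremum_unique)
    interpret function_ring_on R L
      by unfold_locales
        (use L add mult const sep continuous_on_subset[OF cont subset_UNIV] in auto)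
    obtain p where p: "p \<in> R" "p ` L \<subseteq> {0..1}" "\<And>x. x \<in> L - U \<Longrightarrow> p x < \<epsilon>"
      "\<And>x. x \<in> K \<Longrightarrow> p x > 1 - \<epsilon>"
      using two[of "L - U" K \<epsilon>] K L U \<epsilon> compact_imp_closed[OF K] compact_imp_closed[OF L]
      by (force simp: L_def closed_Diff)
    obtain C where C: "\<And>x. \<bar>p x\<bar> \<le> C" using bdd[OF p(1)] by blast
    obtain q where q: "real_polynomial_function q"
      "\<And>t. t \<in> {-C..C} \<Longrightarrow> \<bar>max 0 (min 1 t) - q t\<bar> < \<epsilon>"
    proof (rule Stone_Weierstrass_real_polynomial_function[of "{-C..C}" "\<lambda>t. max 0 (min 1 t)" \<epsilon>])
      show "continuous_on {-C..C} (\<lambda>t. max 0 (min 1 t))" by (intro continuous_intros)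
    qed (use \<epsilon> in auto)
    define f where "f x = q (p x)" for x
    have f: "f \<in> R" unfolding f_def
      by (rule compose_real_polynomial[OF q(1) const add mult p(1)])
    have close: "\<bar>max 0 (min 1 (p x)) - f x\<bar> < \<epsilon>" for x
      unfolding f_def by (rule q(2)) (use C[of x] in auto)
    have [measurable]: "f \<in> borel_measurable borel"
      using cont[OF f] by (rule borel_measurable_continuous_onI)
    obtain D where D: "\<And>x. \<bar>f x\<bar> \<le> D" using bdd[OF f] by blast
    have int: "integrable \<mu> f" "integrable \<rho> f"
      using D by (auto intro!: \<mu>.integrable_const_bound[of _ D] \<rho>.integrable_const_bound[of _ D])
    have lower: "indicator K x - 2 * \<epsilon> \<le> f x" for x
      using close[of x] p(4)[of x] \<epsilon> by (auto simp: indicator_def)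
    have upper: "f x \<le> indicator K x + indicator (U - K) x + indicator (- L) x + 2 * \<epsilon>" for x
    proof -
      have "max 0 (min 1 (p x)) \<le> indicator K x + indicator (U - K) x + indicator (- L) x + \<epsilon>"
        using p(3)[of x] \<epsilon> by (auto simp: indicator_def)
      then show ?thesis using close[of x] by linarith
    qed
    have "measure \<mu> K - 2 * \<epsilon> * measure \<mu> UNIV = (\<integral>x. indicator K x - 2 * \<epsilon> \<partial>\<mu>)"
      using K_borel sets space by (subst Bochner_Integration.integral_diff)
        (auto simp: \<mu>.emeasure_eq_measure)
    also have "\<dots> \<le> (\<integral>x. f x \<partial>\<mu>)"
      by (rule integral_mono) (use lower int K_borel sets in \<open>auto simp: \<mu>.emeasure_eq_measure\<close>)
    also have "\<dots> = (\<integral>x. f x \<partial>\<rho>)" by (rule eq[OF f])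
    also have "\<dots> \<le> (\<integral>x. indicator K x + indicator (U - K) x + indicator (- L) x + 2 * \<epsilon> \<partial>\<rho>)"
      by (rule integral_mono)
        (use upper int K_borel U_borel L_borel sets in \<open>auto simp: \<rho>.emeasure_eq_measure\<close>)
    also have "\<dots> = measure \<rho> K + measure \<rho> (U - K) + measure \<rho> (- L) + 2 * \<epsilon> * measure \<rho> UNIV"
      using K_borel U_borel L_borel sets space by (simp add: \<rho>.emeasure_eq_measure)
    finally show ?thesis using UK rho_L by (simp add: algebra_simps)
  qed
  define c where "c = 2 + 2 * measure \<mu> UNIV + 2 * measure \<rho> UNIV"
  have c: "0 < c" unfolding c_def using measure_nonneg[of \<mu> UNIV] measure_nonneg[of \<rho> UNIV] by linarith
  show ?thesis
  proof (rule field_le_epsilon)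
    fix e :: real assume e: "0 < e"
    define \<epsilon> where "\<epsilon> = min (1 / 2) (e / c)"
    have "0 < \<epsilon>" "\<epsilon> < 1" using e c by (auto simp: \<epsilon>_def)
    then have "measure \<mu> K \<le> measure \<rho> K + \<epsilon> * c" using bound[of \<epsilon>] by (simp add: c_def)
    also have "\<epsilon> * c \<le> e / c * c" using c by (intro mult_right_mono) (auto simp: \<epsilon>_def)
    finally show "measure \<mu> K \<le> measure \<rho> K + e" using c by simp
  qed
qed

text \<open>Inner regularity reduces Borel sets to compact ones.\<close>

lemma finite_regular_borel_eqI:
  fixes \<mu> \<rho> :: "'a::t2_space measure"
  assumes \<mu>: "finite_regular_borel \<mu>" and \<rho>: "finite_regular_borel \<rho>"
    and eq: "\<And>K. compact K \<Longrightarrow> measure \<mu> K = measure \<rho> K"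
  shows "\<mu> = \<rho>"
proof -
  have le: "measure \<mu> B \<le> measure \<rho> B"
    if \<mu>: "finite_regular_borel \<mu>" and \<rho>: "finite_regular_borel \<rho>" and B: "B \<in> sets borel"
      and eq: "\<And>K. compact K \<Longrightarrow> measure \<mu> K = measure \<rho> K" for \<mu> \<rho> :: "'a measure" and B
  proof (rule field_le_epsilon)
    interpret \<mu>: finite_measure \<mu> using \<mu> by (rule finite_regular_borelD)
    interpret \<rho>: finite_measure \<rho> using \<rho> by (rule finite_regular_borelD)
    note sets = finite_regular_borelD(2)[OF \<mu>] finite_regular_borelD(2)[OF \<rho>]
    fix e :: real assume "0 < e"
    then obtain K U where K: "compact K" "open U" "K \<subseteq> B" "B \<subseteq> U" "measure \<mu> (U - K) < e"
      using finite_regular_borel_approx[OF \<mu> B] by blast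
    have "measure \<mu> B \<le> measure \<mu> (K \<union> (U - K))"
      using K B borel_compact[OF K(1)] sets by (intro \<mu>.finite_measure_mono) auto
    also have "\<dots> \<le> measure \<mu> K + measure \<mu> (U - K)"
      using K borel_compact[OF K(1)] sets by (intro measure_Un_le) auto
    also have "\<dots> \<le> measure \<rho> B + e"
      using K(5) eq[OF K(1)] \<rho>.finite_measure_mono[OF K(3)] B sets by auto
    finally show "measure \<mu> B \<le> measure \<rho> B + e" .
  qed
  interpret \<mu>: finite_measure \<mu> using \<mu> by (rule finite_regular_borelD)
  interpret \<rho>: finite_measure \<rho> using \<rho> by (rule finite_regular_borelD)
  show ?thesis
  proof (rule measure_eqI)
    show "sets \<mu> = sets \<rho>"
      using finite_regular_borelD(2)[OF \<mu>] finite_regular_borelD(2)[OF \<rho>] by simp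
    fix B assume "B \<in> sets \<mu>"
    then have "B \<in> sets borel" using finite_regular_borelD(2)[OF \<mu>] by simp
    then have "measure \<mu> B = measure \<rho> B"
      using le[OF \<mu> \<rho>] le[OF \<rho> \<mu>] eq by (metis antisym)
    then show "emeasure \<mu> B = emeasure \<rho> B"
      by (simp add: \<mu>.emeasure_eq_measure \<rho>.emeasure_eq_measure)
  qed
qed

text \<open>The trigonometric polynomials, generated in a way that suits proofs by induction on sums.\<close>

inductive_set trig_functions :: "('g::topological_ab_group_add dual \<Rightarrow> complex) set" where
  monomial: "(\<lambda>\<gamma>. c * \<langle>\<gamma>, x\<rangle>) \<in> trig_functions"
| add: "f \<in> trig_functions \<Longrightarrow> g \<in> trig_functions \<Longrightarrow> (\<lambda>\<gamma>. f \<gamma> + g \<gamma>) \<in> trig_functions"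

lemma pairing_zero_right [simp]: "\<langle>\<gamma>, 0\<rangle> = 1"
  using pairing_add_right[of \<gamma> 0 0] by simp

lemma pairing_uminus_right: "\<langle>\<gamma>, - x\<rangle> = cnj \<langle>\<gamma>, x\<rangle>"
proof -
  have "\<langle>\<gamma>, x\<rangle> * \<langle>\<gamma>, - x\<rangle> = \<langle>\<gamma>, x\<rangle> * cnj \<langle>\<gamma>, x\<rangle>"
    using pairing_add_right[of \<gamma> x "- x"] complex_norm_square[of "\<langle>\<gamma>, x\<rangle>"] by simp
  then show ?thesis by simp
qed

lemma trig_functions_const: "(\<lambda>_. c) \<in> trig_functions"
  using trig_functions.monomial[of c 0] by simp

lemma trig_functions_mult:
  assumes "f \<in> trig_functions" "g \<in> trig_functions"
  shows "(\<lambda>\<gamma>. f \<gamma> * g \<gamma>) \<in> trig_functions"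
  using assms(1)
proof induction
  case (monomial c x)
  show ?case
    using assms(2)
  proof induction
    case (monomial d y)
    show ?case
      using trig_functions.monomial[of "c * d" "x + y"] by (simp add: pairing_add_right mult_ac)
  qed (use trig_functions.add in \<open>auto simp: distrib_left\<close>)
qed (use trig_functions.add in \<open>auto simp: distrib_right\<close>)

lemma trig_functions_continuous:
  assumes "f \<in> trig_functions"
  shows "continuous_on UNIV f"
  using assms by induction (auto intro!: continuous_intros continuous_pairing_left)

lemma trig_functions_bounded:
  assumes "f \<in> trig_functions"
  shows "\<exists>C. \<forall>\<gamma>. cmod (f \<gamma>) \<le> C"
  using assms
proof induction
  case (monomial c x)
  then show ?case by (auto simp: norm_mult)
next
  case (add f g)
  then obtain C D where "\<And>\<gamma>. cmod (f \<gamma>) \<le> C" "\<And>\<gamma>. cmod (g \<gamma>) \<le> D" by blast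
  then show ?case
    by (intro exI[of _ "C + D"] allI order_trans[OF norm_triangle_ineq] add_mono) auto
qed

lemma integrable_pairing:
  assumes "finite_measure \<mu>" "sets \<mu> = sets borel"
  shows "integrable \<mu> (\<lambda>\<gamma>. \<langle>\<gamma>, x\<rangle>)"
proof -
  interpret finite_measure \<mu> by fact
  note assms(2)[measurable_cong]
  show ?thesis by (rule integrable_const_bound[of _ 1]) auto
qed

text \<open>The real-valued trigonometric polynomials form an algebra that separates points, because two elements of the dual
  group differ as functions on \<open>G\<close>.\<close>

theorem fourier_transform_injective:
  fixes \<mu> \<rho> :: "'g::topological_ab_group_add dual measure"
  assumes \<mu>: "finite_regular_borel \<mu>" and \<rho>: "finite_regular_borel \<rho>"
    and eq: "\<And>x. (\<integral>\<gamma>. \<langle>\<gamma>, x\<rangle> \<partial>\<mu>) = (\<integral>\<gamma>. \<langle>\<gamma>, x\<rangle> \<partial>\<rho>)"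
  shows "\<mu> = \<rho>"
proof -
  have int: "integrable \<mu> (\<lambda>\<gamma>. \<langle>\<gamma>, x\<rangle>)" "integrable \<rho> (\<lambda>\<gamma>. \<langle>\<gamma>, x\<rangle>)" for x
    using \<mu> \<rho> by (auto intro: integrable_pairing dest: finite_regular_borelD)
  have trig: "integrable \<mu> f \<and> integrable \<rho> f \<and> (\<integral>\<gamma>. f \<gamma> \<partial>\<mu>) = (\<integral>\<gamma>. f \<gamma> \<partial>\<rho>)"
    if "f \<in> trig_functions" for f
    using that by induction (use int eq in auto)
  define R where "R = {f. (\<lambda>\<gamma>. complex_of_real (f \<gamma>)) \<in> (trig_functions :: ('g dual \<Rightarrow> complex) set)}"
  have const: "(\<lambda>_. c) \<in> R" for c
    using trig_functions_const by (simp add: R_def)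
  have add: "(\<lambda>\<gamma>. f \<gamma> + g \<gamma>) \<in> R" if "f \<in> R" "g \<in> R" for f g
    using that trig_functions.add by (auto simp: R_def)
  have mult: "(\<lambda>\<gamma>. f \<gamma> * g \<gamma>) \<in> R" if "f \<in> R" "g \<in> R" for f g
    using that trig_functions_mult by (auto simp: R_def)
  have cont: "continuous_on UNIV f" if "f \<in> R" for f
    using continuous_on_Re[OF trig_functions_continuous[of "\<lambda>\<gamma>. complex_of_real (f \<gamma>)"]] that
    by (simp add: R_def)
  have bdd: "\<exists>C. \<forall>\<gamma>. \<bar>f \<gamma>\<bar> \<le> C" if "f \<in> R" for f
    using trig_functions_bounded[of "\<lambda>\<gamma>. complex_of_real (f \<gamma>)"] that by (simp add: R_def)
  have Re_R: "(\<lambda>\<gamma>. Re (c * \<langle>\<gamma>, x\<rangle>)) \<in> R" for c x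
  proof -
    have "complex_of_real (Re (c * \<langle>\<gamma>, x\<rangle>)) = c / 2 * \<langle>\<gamma>, x\<rangle> + cnj c / 2 * \<langle>\<gamma>, - x\<rangle>" for \<gamma> :: "'g dual"
      by (simp add: pairing_uminus_right complex_eq_iff field_simps)
    then show ?thesis
      unfolding R_def using trig_functions.add[OF trig_functions.monomial[of "c / 2" x]
          trig_functions.monomial[of "cnj c / 2" "- x"]] by simp
  qed
  have sep: "\<exists>f\<in>R. f \<gamma> \<noteq> f \<theta>" if ne: "\<gamma> \<noteq> \<theta>" for \<gamma> \<theta>
  proof -
    obtain x where "\<langle>\<gamma>, x\<rangle> \<noteq> \<langle>\<theta>, x\<rangle>" using ne dual_eqI by blast
    then have "Re (1 * \<langle>\<gamma>, x\<rangle>) \<noteq> Re (1 * \<langle>\<theta>, x\<rangle>) \<or> Re (- \<i> * \<langle>\<gamma>, x\<rangle>) \<noteq> Re (- \<i> * \<langle>\<theta>, x\<rangle>)"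
      by (auto simp: complex_eq_iff)
    then show ?thesis
      using bexI[OF _ Re_R[of 1 x], of "\<lambda>f. f \<gamma> \<noteq> f \<theta>"]
        bexI[OF _ Re_R[of "- \<i>" x], of "\<lambda>f. f \<gamma> \<noteq> f \<theta>"] by blast
  qed
  have eqR: "(\<integral>\<gamma>. f \<gamma> \<partial>\<mu>) = (\<integral>\<gamma>. f \<gamma> \<partial>\<rho>)" if "f \<in> R" for f
    using trig[of "\<lambda>\<gamma>. complex_of_real (f \<gamma>)"] that by (simp add: R_def)
  show ?thesis
  proof (rule finite_regular_borel_eqI[OF \<mu> \<rho>])
    fix K :: "'g dual set" assume K: "compact K"
    show "measure \<mu> K = measure \<rho> K"
      using measure_compact_le_of_integrals_eq[OF \<mu> \<rho> const add mult cont bdd sep eqR K]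
        measure_compact_le_of_integrals_eq[OF \<rho> \<mu> const add mult cont bdd sep eqR[symmetric] K]
      by (rule antisym)
  qed
qed

section \<open>Orthogonality in terms of the Fourier-Stieltjes transform\<close>

lemma integrable_L2_mult:
  assumes sets: "sets \<mu> = sets borel" and f: "f \<in> L2 \<mu>" and g: "g \<in> L2 \<mu>"
  shows "integrable \<mu> (\<lambda>\<gamma>. f \<gamma> * cnj (g \<gamma>))"
proof (rule Bochner_Integration.integrable_bound)
  note sets[measurable_cong]
  have [measurable]: "f \<in> borel_measurable borel" "g \<in> borel_measurable borel"
    using f g by (auto simp: L2_def)
  have [measurable]: "(\<lambda>\<gamma>. cnj (g \<gamma>)) \<in> borel_measurable borel"
    by (rule borel_measurable_continuous_on[of cnj]) (auto intro!: continuous_intros)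
  show "integrable \<mu> (\<lambda>\<gamma>. (cmod (f \<gamma>))\<^sup>2 + (cmod (g \<gamma>))\<^sup>2)"
    using f g by (auto simp: L2_def)
  show "(\<lambda>\<gamma>. f \<gamma> * cnj (g \<gamma>)) \<in> borel_measurable \<mu>" by measurable
  have "a * b \<le> a\<^sup>2 + b\<^sup>2" if "0 \<le> a" "0 \<le> b" for a b :: real
    using sum_squares_bound[of a b] that zero_le_mult_iff[of a b] by linarith
  then show "AE \<gamma> in \<mu>. norm (f \<gamma> * cnj (g \<gamma>)) \<le> norm ((cmod (f \<gamma>))\<^sup>2 + (cmod (g \<gamma>))\<^sup>2)"
    by (simp add: norm_mult)
qed

text \<open>The Cauchy-Schwarz inequality in additive form, up to a constant. A suitable \<open>t\<close> makes the right-hand side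
  small as soon as one of the two norms is.\<close>

lemma cmod_L2_inner_le:
  assumes sets: "sets \<mu> = sets borel" and f: "f \<in> L2 \<mu>" and g: "g \<in> L2 \<mu>" and t: "0 < t"
  shows "cmod (L2_inner \<mu> f g) \<le> t * (L2_norm \<mu> f)\<^sup>2 + (L2_norm \<mu> g)\<^sup>2 / t"
proof -
  have int: "integrable \<mu> (\<lambda>\<gamma>. (cmod (f \<gamma>))\<^sup>2)" "integrable \<mu> (\<lambda>\<gamma>. (cmod (g \<gamma>))\<^sup>2)"
    using f g by (auto simp: L2_def)
  have ineq: "a * b \<le> t * a\<^sup>2 + b\<^sup>2 / t" if "0 \<le> a" "0 \<le> b" for a b :: real
  proof -
    have "0 \<le> (t * a - b)\<^sup>2" by simp
    then have "2 * (t * (a * b)) \<le> t * (t * a\<^sup>2) + b\<^sup>2" by (simp add: power2_eq_square algebra_simps)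
    moreover have "0 \<le> t * (a * b)" using t that by simp
    ultimately have "t * (a * b) \<le> t * (t * a\<^sup>2) + b\<^sup>2" by linarith
    also have "\<dots> = t * (t * a\<^sup>2 + b\<^sup>2 / t)" using t by (simp add: distrib_left)
    finally have "t * (a * b) \<le> t * (t * a\<^sup>2 + b\<^sup>2 / t)" .
    then show ?thesis using t by simp
  qed
  have "cmod (L2_inner \<mu> f g) \<le> (\<integral>\<gamma>. cmod (f \<gamma> * cnj (g \<gamma>)) \<partial>\<mu>)"
    unfolding L2_inner_def by (rule integral_norm_bound)
  also have "\<dots> \<le> (\<integral>\<gamma>. t * (cmod (f \<gamma>))\<^sup>2 + (cmod (g \<gamma>))\<^sup>2 / t \<partial>\<mu>)"
    by (rule integral_mono)
      (use integrable_norm[OF integrable_L2_mult[OF sets f g]] int ineq in \<open>auto simp: norm_mult\<close>)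
  also have "\<dots> = t * (L2_norm \<mu> f)\<^sup>2 + (L2_norm \<mu> g)\<^sup>2 / t"
    using int by (simp add: L2_norm_def)
  finally show ?thesis .
qed

lemma L2_diff:
  assumes sets: "sets \<mu> = sets borel" and f: "f \<in> L2 \<mu>" and g: "g \<in> L2 \<mu>"
  shows "(\<lambda>\<gamma>. f \<gamma> - g \<gamma>) \<in> L2 \<mu>"
proof -
  note sets[measurable_cong]
  have [measurable]: "f \<in> borel_measurable borel" "g \<in> borel_measurable borel"
    using f g by (auto simp: L2_def)
  have "integrable \<mu> (\<lambda>\<gamma>. (cmod (f \<gamma> - g \<gamma>))\<^sup>2)"
  proof (rule Bochner_Integration.integrable_bound)
    show "integrable \<mu> (\<lambda>\<gamma>. 2 * (cmod (f \<gamma>))\<^sup>2 + 2 * (cmod (g \<gamma>))\<^sup>2)"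
      using f g by (auto simp: L2_def)
    have "(cmod (a - b))\<^sup>2 \<le> 2 * (cmod a)\<^sup>2 + 2 * (cmod b)\<^sup>2" for a b
    proof -
      have "(cmod (a - b))\<^sup>2 \<le> (cmod a + cmod b)\<^sup>2"
        by (intro power_mono norm_triangle_ineq4) simp
      also have "\<dots> \<le> 2 * (cmod a)\<^sup>2 + 2 * (cmod b)\<^sup>2"
        using sum_squares_bound[of "cmod a" "cmod b"] by (simp add: power2_sum)
      finally show ?thesis .
    qed
    then show "AE \<gamma> in \<mu>. norm ((cmod (f \<gamma> - g \<gamma>))\<^sup>2) \<le> norm (2 * (cmod (f \<gamma>))\<^sup>2 + 2 * (cmod (g \<gamma>))\<^sup>2)"
      by simp
  qed measurable
  then show ?thesis by (simp add: L2_def)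
qed

lemma L2_inner_commute: "L2_inner \<mu> g f = cnj (L2_inner \<mu> f g)"
  unfolding L2_inner_def Bochner_Integration.integral_cnj[symmetric] by (simp add: mult.commute)

lemma L2_inner_closure_right:
  assumes sets: "sets \<mu> = sets borel" and f: "f \<in> L2 \<mu>" and g: "g \<in> L2_closure \<mu> M"
    and orth: "\<And>q. q \<in> M \<Longrightarrow> L2_inner \<mu> f q = 0"
  shows "L2_inner \<mu> f g = 0"
proof -
  have g2: "g \<in> L2 \<mu>" using g by (simp add: L2_closure_def)
  have "cmod (L2_inner \<mu> f g) \<le> 0 + e" if e: "0 < e" for e
  proof -
    define t where "t = e / (2 * ((L2_norm \<mu> f)\<^sup>2 + 1))"
    have N: "0 < (L2_norm \<mu> f)\<^sup>2 + 1" by (rule add_nonneg_pos) auto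
    have t: "0 < t" using e N by (simp add: t_def)
    have tN: "t * (L2_norm \<mu> f)\<^sup>2 \<le> e / 2"
    proof -
      have "t * (L2_norm \<mu> f)\<^sup>2 \<le> t * ((L2_norm \<mu> f)\<^sup>2 + 1)" using t by simp
      also have "\<dots> = e / 2" using less_imp_neq[OF N] unfolding t_def by (simp only: times_divide_eq_left mult_divide_mult_cancel_right)
      finally show ?thesis .
    qed
    obtain q where q: "q \<in> M" "q \<in> L2 \<mu>" "L2_norm \<mu> (\<lambda>\<gamma>. g \<gamma> - q \<gamma>) < sqrt (t * (e / 2))"
      using g t e unfolding L2_closure_def by (auto dest: spec[of _ "sqrt (t * (e / 2))"])
    have "0 \<le> L2_norm \<mu> (\<lambda>\<gamma>. g \<gamma> - q \<gamma>)" by (simp add: L2_norm_def)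
    then have "(L2_norm \<mu> (\<lambda>\<gamma>. g \<gamma> - q \<gamma>))\<^sup>2 \<le> (sqrt (t * (e / 2)))\<^sup>2"
      using q(3) by (intro power_mono) auto
    then have small: "(L2_norm \<mu> (\<lambda>\<gamma>. g \<gamma> - q \<gamma>))\<^sup>2 / t \<le> e / 2"
      using t e by (simp add: field_simps)
    have "L2_inner \<mu> f g = L2_inner \<mu> f g - L2_inner \<mu> f q" using orth[OF q(1)] by simp
    also have "\<dots> = L2_inner \<mu> f (\<lambda>\<gamma>. g \<gamma> - q \<gamma>)"
      using integrable_L2_mult[OF sets f g2] integrable_L2_mult[OF sets f q(2)]
      by (simp add: L2_inner_def right_diff_distrib)
    also have "cmod \<dots> \<le> t * (L2_norm \<mu> f)\<^sup>2 + (L2_norm \<mu> (\<lambda>\<gamma>. g \<gamma> - q \<gamma>))\<^sup>2 / t"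
      by (rule cmod_L2_inner_le[OF sets f L2_diff[OF sets g2 q(2)] t])
    also have "\<dots> \<le> 0 + e" using tN small by linarith
    finally show ?thesis .
  qed
  then have "cmod (L2_inner \<mu> f g) \<le> 0" by (rule field_le_epsilon)
  then show ?thesis by simp
qed

lemma L2_orthogonal_closure:
  assumes sets: "sets \<mu> = sets borel" and L: "L \<subseteq> L2 \<mu>" and orth: "L2_orthogonal \<mu> L M"
  shows "L2_orthogonal \<mu> (L2_closure \<mu> L) (L2_closure \<mu> M)"
  unfolding L2_orthogonal_def
proof (intro ballI)
  fix f g assume f: "f \<in> L2_closure \<mu> L" and g: "g \<in> L2_closure \<mu> M"
  have g2: "g \<in> L2 \<mu>" using g by (simp add: L2_closure_def)
  have "L2_inner \<mu> p g = 0" if "p \<in> L" for p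
    by (rule L2_inner_closure_right[OF sets _ g]) (use that L orth in \<open>auto simp: L2_orthogonal_def\<close>)
  then have "L2_inner \<mu> g p = 0" if "p \<in> L" for p
    using that L2_inner_commute[of \<mu> g p] by simp
  then have "L2_inner \<mu> g f = 0" by (rule L2_inner_closure_right[OF sets g2 f])
  then show "L2_inner \<mu> f g = 0" using L2_inner_commute[of \<mu> f g] by simp
qed

lemma subset_L2_closure: "L \<subseteq> L2 \<mu> \<Longrightarrow> L \<subseteq> L2_closure \<mu> L"
  by (auto simp: L2_closure_def L2_norm_def intro!: bexI)

lemma character_in_trig_poly: "s \<in> S \<Longrightarrow> (\<lambda>\<gamma>. \<langle>\<gamma>, s\<rangle>) \<in> trig_poly S"
  unfolding trig_poly_def by (intro CollectI exI[of _ "{s}"] exI[of _ "\<lambda>_. 1"]) auto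

lemma pairing_mult_cnj: "\<langle>\<gamma>, s\<rangle> * cnj \<langle>\<gamma>, t\<rangle> = \<langle>\<gamma>, s - t\<rangle>"
  using pairing_add_right[of \<gamma> s "- t"] by (simp add: pairing_uminus_right)

text \<open>The inner product of the characters at \<open>s\<close> and \<open>t\<close> is the transform at \<open>s - t\<close>. Elements of
  different cosets of \<open>H\<close> have their difference off \<open>H\<close>, and every \<open>z \<notin> H\<close> is such a difference, of
  \<open>z\<close> and \<open>0\<close>.\<close>

lemma pairwise_orthogonal_iff_fourier_zero:
  assumes \<mu>: "finite_measure \<mu>" "sets \<mu> = sets borel" and H: "add_subgroup H"
  shows "pairwise_orthogonal_cosets \<mu> H \<longleftrightarrow> (\<forall>z. z \<notin> H \<longrightarrow> (\<integral>\<gamma>. \<langle>\<gamma>, z\<rangle> \<partial>\<mu>) = 0)"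
proof
  assume orth: "pairwise_orthogonal_cosets \<mu> H"
  show "\<forall>z. z \<notin> H \<longrightarrow> (\<integral>\<gamma>. \<langle>\<gamma>, z\<rangle> \<partial>\<mu>) = 0"
  proof (intro allI impI)
    fix z assume z: "z \<notin> H"
    have mem: "x \<in> x +o H" for x
      using H by (auto simp: elt_set_plus_def add_subgroup_def intro: bexI[of _ 0])
    have "z +o H \<noteq> 0 +o H" using z mem[of z] by (auto simp: elt_set_plus_def)
    then have "L2_orthogonal \<mu> (L2_closure \<mu> (trig_poly (z +o H))) (L2_closure \<mu> (trig_poly (0 +o H)))"
      using orth unfolding pairwise_orthogonal_cosets_def pairwise_def cosets_of_def by blast
    then have "L2_inner \<mu> (\<lambda>\<gamma>. \<langle>\<gamma>, z\<rangle>) (\<lambda>\<gamma>. \<langle>\<gamma>, 0\<rangle>) = 0"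
      using character_in_trig_poly[OF mem[of z]] character_in_trig_poly[OF mem[of 0]]
        subset_L2_closure[OF trig_poly_subset_L2[OF \<mu>]]
      unfolding L2_orthogonal_def by blast
    then show "(\<integral>\<gamma>. \<langle>\<gamma>, z\<rangle> \<partial>\<mu>) = 0" by (simp add: L2_inner_def)
  qed
next
  assume zero: "\<forall>z. z \<notin> H \<longrightarrow> (\<integral>\<gamma>. \<langle>\<gamma>, z\<rangle> \<partial>\<mu>) = 0"
  show "pairwise_orthogonal_cosets \<mu> H"
    unfolding pairwise_orthogonal_cosets_def pairwise_def
  proof (intro ballI impI)
    fix C D assume "C \<in> cosets_of H" "D \<in> cosets_of H" and ne: "C \<noteq> D"
    then obtain x y where C: "C = x +o H" and D: "D = y +o H" unfolding cosets_of_def by blast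
    have st: "s - t \<notin> H" if "s \<in> C" "t \<in> D" for s t
    proof
      assume "s - t \<in> H"
      obtain h h' where h: "h \<in> H" "s = x + h" "h' \<in> H" "t = y + h'"
        using \<open>s \<in> C\<close> \<open>t \<in> D\<close> by (auto simp: C D elt_set_plus_def)
      have sub: "a - b \<in> H" if "a \<in> H" "b \<in> H" for a b
        using H that unfolding add_subgroup_def by (metis diff_conv_add_uminus)
      have "(s - t) - (h - h') \<in> H" using sub h \<open>s - t \<in> H\<close> by blast
      then have xy: "x - y \<in> H" using h by (simp add: algebra_simps)
      have add: "a + b \<in> H" if "a \<in> H" "b \<in> H" for a b
        using H that unfolding add_subgroup_def by blast
      have "C = D"
      proof (intro set_eqI iffI)
        fix u assume "u \<in> C"
        then obtain k where k: "k \<in> H" "u = x + k" by (auto simp: C elt_set_plus_def)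
        then have "u = y + ((x - y) + k)" by simp
        with add[OF xy k(1)] show "u \<in> D" unfolding D elt_set_plus_def by blast
      next
        fix u assume "u \<in> D"
        then obtain k where k: "k \<in> H" "u = y + k" by (auto simp: D elt_set_plus_def)
        then have "u = x + (k - (x - y))" by simp
        with sub[OF k(1) xy] show "u \<in> C" unfolding C elt_set_plus_def by blast
      qed
      with ne show False by simp
    qed
    have "L2_orthogonal \<mu> (trig_poly C) (trig_poly D)"
      unfolding L2_orthogonal_def
    proof (intro ballI)
      fix p q assume "p \<in> trig_poly C" "q \<in> trig_poly D"
      then obtain F a F' b where p: "p = (\<lambda>\<gamma>. \<Sum>s\<in>F. a s * \<langle>\<gamma>, s\<rangle>)" "F \<subseteq> C"
        and q: "q = (\<lambda>\<gamma>. \<Sum>t\<in>F'. b t * \<langle>\<gamma>, t\<rangle>)" "F' \<subseteq> D"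
        unfolding trig_poly_def by blast
      have "p \<gamma> * cnj (q \<gamma>) = (\<Sum>s\<in>F. \<Sum>t\<in>F'. a s * cnj (b t) * \<langle>\<gamma>, s - t\<rangle>)" for \<gamma>
        unfolding p(1) q(1) cnj_sum sum_product
        by (intro sum.cong refl) (simp add: pairing_mult_cnj[symmetric] mult_ac)
      then have "L2_inner \<mu> p q = (\<Sum>s\<in>F. \<Sum>t\<in>F'. a s * cnj (b t) * (\<integral>\<gamma>. \<langle>\<gamma>, s - t\<rangle> \<partial>\<mu>))"
        unfolding L2_inner_def using integrable_pairing[OF \<mu>]
        by (simp add: Bochner_Integration.integral_sum)
      also have "\<dots> = 0"
      proof (intro sum.neutral ballI)
        fix s t assume "s \<in> F" "t \<in> F'"
        then show "a s * cnj (b t) * (\<integral>\<gamma>. \<langle>\<gamma>, s - t\<rangle> \<partial>\<mu>) = 0"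
          using zero st[of s t] p(2) q(2) by auto
      qed
      finally show "L2_inner \<mu> p q = 0" .
    qed
    then show "L2_orthogonal \<mu> (L2_closure \<mu> (trig_poly C)) (L2_closure \<mu> (trig_poly D))"
      by (rule L2_orthogonal_closure[OF \<mu>(2) trig_poly_subset_L2[OF \<mu>]])
  qed
qed

section \<open>Invariance under the annihilator\<close>

abbreviation translated :: "'a::{topological_ab_group_add, t2_space} measure \<Rightarrow> 'a \<Rightarrow> 'a measure" where
  "translated \<mu> c \<equiv> distr \<mu> borel (\<lambda>\<gamma>. \<gamma> - c)"

lemma measurable_translate_from:
  fixes c :: "'a::{topological_ab_group_add, t2_space}"
  assumes "sets \<mu> = sets borel"
  shows "(\<lambda>\<gamma>. \<gamma> - c) \<in> measurable \<mu> borel"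
  using measurable_translate(2)[of c] assms by (simp cong: measurable_cong_sets)

lemma emeasure_translated:
  fixes c :: "'a::{topological_ab_group_add, t2_space}"
  assumes "sets \<mu> = sets borel" "B \<in> sets borel"
  shows "emeasure (translated \<mu> c) B = emeasure \<mu> (c +o B)"
  using assms sets_eq_imp_space_eq[OF assms(1)]
  by (simp add: emeasure_distr[OF measurable_translate_from] translate_eq_vimage)

lemma finite_regular_borel_translated:
  fixes c :: "'a::{topological_ab_group_add, t2_space}"
  assumes \<mu>: "finite_regular_borel \<mu>"
  shows "finite_regular_borel (translated \<mu> c)"
  unfolding finite_regular_borel_def
proof (intro conjI ballI allI impI)
  note sets = finite_regular_borelD(2)[OF \<mu>]
  interpret finite_measure \<mu> using \<mu> by (rule finite_regular_borelD)
  show "finite_measure (translated \<mu> c)"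
    by (rule finite_measure_distr[OF measurable_translate_from[OF sets]])
  show "sets (translated \<mu> c) = sets borel" by simp
  fix B :: "'a set" and e :: real assume B: "B \<in> sets borel" and e: "0 < e"
  obtain K U where KU: "compact K" "open U" "K \<subseteq> c +o B" "c +o B \<subseteq> U" "measure \<mu> (U - K) < e"
    using finite_regular_borel_approx[OF \<mu> translate_in_borel[OF B] e] by blast
  have c: "continuous_on UNIV (\<lambda>\<gamma>. \<gamma> - c)" "continuous_on UNIV (\<lambda>\<gamma>. \<gamma> + c)"
    by (intro continuous_intros)+
  define K' where "K' = (\<lambda>\<gamma>. \<gamma> - c) ` K"
  define U' where "U' = (\<lambda>\<gamma>. \<gamma> + c) -` U"
  have K': "compact K'"
    unfolding K'_def by (rule compact_continuous_image[OF continuous_on_subset[OF c(1)] KU(1)]) simp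
  have U': "open U'" unfolding U'_def by (rule open_vimage[OF KU(2) c(2)])
  have "K' \<subseteq> B" using KU(3) by (auto simp: K'_def translate_eq_vimage)
  moreover have "B \<subseteq> U'" using KU(4) unfolding U'_def translate_eq_vimage by (metis add_diff_cancel_right' subsetD subsetI vimageI2 vimage_eq)
  moreover have "measure (translated \<mu> c) (U' - K') = measure \<mu> (U - K)"
  proof -
    have UK: "U' - K' \<in> sets borel" using U' borel_compact[OF K'] by auto
    have "c +o (U' - K') = U - K"
      by (auto simp: translate_eq_vimage U'_def K'_def image_iff)
    then show ?thesis
      using emeasure_translated[OF sets UK, of c] by (simp add: measure_def)
  qed
  ultimately show "\<exists>K U. compact K \<and> open U \<and> K \<subseteq> B \<and> B \<subseteq> U \<and> measure (translated \<mu> c) (U - K) < e"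
    using K' U' KU(5) by metis
qed

lemma integral_pairing_translated:
  fixes \<mu> :: "'g::topological_ab_group_add dual measure"
  assumes "sets \<mu> = sets borel"
  shows "(\<integral>\<gamma>. \<langle>\<gamma>, z\<rangle> \<partial>translated \<mu> \<kappa>) = cnj \<langle>\<kappa>, z\<rangle> * (\<integral>\<gamma>. \<langle>\<gamma>, z\<rangle> \<partial>\<mu>)"
proof -
  have "(\<integral>\<gamma>. \<langle>\<gamma>, z\<rangle> \<partial>translated \<mu> \<kappa>) = (\<integral>\<gamma>. \<langle>\<gamma> - \<kappa>, z\<rangle> \<partial>\<mu>)"
    by (rule integral_distr[OF measurable_translate_from[OF assms]]) simp
  also have "\<dots> = (\<integral>\<gamma>. cnj \<langle>\<kappa>, z\<rangle> * \<langle>\<gamma>, z\<rangle> \<partial>\<mu>)"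
    using pairing_add_left[of _ "- \<kappa>" z] by (simp add: pairing_uminus_left mult.commute)
  finally show ?thesis by simp
qed

text \<open>Invariance makes the transform at \<open>z\<close> a multiple of itself by the conjugate of \<open>\<langle>\<kappa>, z\<rangle>\<close>; separation of
  \<open>z\<close> from \<open>H\<close> provides \<open>\<kappa>\<close> with a factor other than \<open>1\<close>. In the other direction, the transforms of
  \<open>\<mu>\<close> and its translate agree: on \<open>H\<close> because \<open>\<kappa>\<close> is trivial there, off \<open>H\<close> because both vanish.\<close>

lemma annihilator_invariant_iff_fourier_zero:
  fixes \<mu> :: "'g::topological_ab_group_add dual measure"
  assumes lc: "locally_compact_space (euclidean :: 'g topology)"
    and H: "add_subgroup H" "closed H" and \<mu>: "finite_regular_borel \<mu>"
  shows "(\<forall>\<kappa>\<in>annihilator H. translated \<mu> \<kappa> = \<mu>) \<longleftrightarrow>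
      (\<forall>z. z \<notin> H \<longrightarrow> (\<integral>\<gamma>. \<langle>\<gamma>, z\<rangle> \<partial>\<mu>) = 0)"
proof
  note sets = finite_regular_borelD(2)[OF \<mu>]
  {
    assume inv: "\<forall>\<kappa>\<in>annihilator H. translated \<mu> \<kappa> = \<mu>"
    show "\<forall>z. z \<notin> H \<longrightarrow> (\<integral>\<gamma>. \<langle>\<gamma>, z\<rangle> \<partial>\<mu>) = 0"
    proof (intro allI impI)
      fix z assume "z \<notin> H"
      then obtain \<kappa> where \<kappa>: "\<kappa> \<in> annihilator H" "\<langle>\<kappa>, z\<rangle> \<noteq> 1"
        using annihilator_separates_points[OF lc H] by blast
      have "cnj \<langle>\<kappa>, z\<rangle> * (\<integral>\<gamma>. \<langle>\<gamma>, z\<rangle> \<partial>\<mu>) = (\<integral>\<gamma>. \<langle>\<gamma>, z\<rangle> \<partial>\<mu>)"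
        using integral_pairing_translated[OF sets, where z = z and \<kappa> = \<kappa>] inv \<kappa>(1) by simp
      then show "(\<integral>\<gamma>. \<langle>\<gamma>, z\<rangle> \<partial>\<mu>) = 0"
        using \<kappa>(2) by (metis complex_cnj_one_iff mult_cancel_right1)
    qed
  next
    assume zero: "\<forall>z. z \<notin> H \<longrightarrow> (\<integral>\<gamma>. \<langle>\<gamma>, z\<rangle> \<partial>\<mu>) = 0"
    show "\<forall>\<kappa>\<in>annihilator H. translated \<mu> \<kappa> = \<mu>"
    proof
      fix \<kappa> assume \<kappa>: "\<kappa> \<in> annihilator H"
      show "translated \<mu> \<kappa> = \<mu>"
      proof (rule fourier_transform_injective[OF finite_regular_borel_translated[OF \<mu>] \<mu>])
        fix z
        show "(\<integral>\<gamma>. \<langle>\<gamma>, z\<rangle> \<partial>translated \<mu> \<kappa>) = (\<integral>\<gamma>. \<langle>\<gamma>, z\<rangle> \<partial>\<mu>)"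
          unfolding integral_pairing_translated[OF sets]
          using zero \<kappa> by (cases "z \<in> H") (auto simp: annihilator_def)
      qed
    qed
  }
qed

section \<open>Decomposition along a transversal\<close>

lemma transversal_translates:
  assumes \<Lambda>: "add_subgroup \<Lambda>" and T: "transversal \<Lambda> T"
  shows "disjoint_family_on (\<lambda>\<kappa>. \<kappa> +o T) \<Lambda>" "(\<Union>\<kappa>\<in>\<Lambda>. \<kappa> +o T) = UNIV"
proof -
  have zero: "0 \<in> \<Lambda>" and neg: "\<And>\<kappa>. \<kappa> \<in> \<Lambda> \<Longrightarrow> - \<kappa> \<in> \<Lambda>"
    and sub: "\<And>\<kappa> \<theta>. \<kappa> \<in> \<Lambda> \<Longrightarrow> \<theta> \<in> \<Lambda> \<Longrightarrow> \<kappa> - \<theta> \<in> \<Lambda>"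
    using \<Lambda> unfolding add_subgroup_def by (auto simp: diff_conv_add_uminus simp del: add_uminus_conv_diff)
  show "disjoint_family_on (\<lambda>\<kappa>. \<kappa> +o T) \<Lambda>"
    unfolding disjoint_family_on_def
  proof (intro ballI impI, rule ccontr)
    fix \<kappa> \<theta> assume \<kappa>: "\<kappa> \<in> \<Lambda>" and \<theta>: "\<theta> \<in> \<Lambda>" and ne: "\<kappa> \<noteq> \<theta>"
      and "(\<kappa> +o T) \<inter> (\<theta> +o T) \<noteq> {}"
    then obtain t t' where t: "t \<in> T" "t' \<in> T" "\<kappa> + t = \<theta> + t'" by (auto simp: elt_set_plus_def)
    have "t' = t + (\<kappa> - \<theta>)" using t(3) by (simp add: algebra_simps)
    then have "t' \<in> t +o \<Lambda>" using sub[OF \<kappa> \<theta>] by (auto simp: elt_set_plus_def)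
    moreover have "t \<in> t +o \<Lambda>" using zero by (auto simp: elt_set_plus_def intro: bexI[of _ 0])
    moreover have "t +o \<Lambda> \<in> cosets_of \<Lambda>" by (simp add: cosets_of_def)
    ultimately have "t = t'" using T t(1,2) unfolding transversal_def by blast
    with t(3) ne show False by simp
  qed
  show "(\<Union>\<kappa>\<in>\<Lambda>. \<kappa> +o T) = UNIV"
  proof (intro equalityI subset_UNIV subsetI)
    fix \<gamma>
    have "\<gamma> +o \<Lambda> \<in> cosets_of \<Lambda>" by (simp add: cosets_of_def)
    then obtain t where "t \<in> T" "t \<in> \<gamma> +o \<Lambda>" using T unfolding transversal_def by blast
    then obtain \<kappa> where \<kappa>: "\<kappa> \<in> \<Lambda>" "\<gamma> + \<kappa> \<in> T" by (auto simp: elt_set_plus_def)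
    then have "\<gamma> \<in> (- \<kappa>) +o T" by (auto simp: elt_set_plus_def intro: bexI[of _ "\<gamma> + \<kappa>"])
    with neg[OF \<kappa>(1)] show "\<gamma> \<in> (\<Union>\<kappa>\<in>\<Lambda>. \<kappa> +o T)" by blast
  qed
qed

text \<open>This form shows that \<open>nu_part \<mu> T \<kappa>\<close> is the restriction to \<open>T\<close> of a translate of \<open>\<mu>\<close>.\<close>

lemma emeasure_nu_part_eq:
  fixes T B :: "'a::{topological_ab_group_add, t2_space} set"
  assumes "sets \<mu> = sets borel" "T \<in> sets borel" "B \<in> sets borel"
  shows "emeasure (nu_part \<mu> T \<kappa>) B = emeasure \<mu> (\<kappa> +o (B \<inter> T))"
  using emeasure_nu_part[OF assms(1,3), of T \<kappa>]
    emeasure_mu_part[OF assms(1,2) translate_in_borel[OF assms(3)], of \<kappa> \<kappa>]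
  by (simp add: translate_eq_vimage vimage_Int)

lemma emeasure_decompose_translates:
  fixes T B :: "'a::{topological_ab_group_add, t2_space} set"
  assumes sets: "sets \<mu> = sets borel" and T: "T \<in> sets borel" "transversal \<Lambda> T"
    and \<Lambda>: "add_subgroup \<Lambda>" "countable \<Lambda>" and B: "B \<in> sets borel"
  shows "emeasure \<mu> B = (\<integral>\<^sup>+\<kappa>. emeasure (nu_part \<mu> T \<kappa>) ((- \<kappa>) +o B) \<partial>count_space \<Lambda>)"
proof -
  have "emeasure \<mu> B = emeasure \<mu> (\<Union>\<kappa>\<in>\<Lambda>. B \<inter> (\<kappa> +o T))"
    using transversal_translates(2)[OF \<Lambda>(1) T(2)] by (simp flip: Int_UN_distrib)
  also have "\<dots> = (\<integral>\<^sup>+\<kappa>. emeasure \<mu> (B \<inter> (\<kappa> +o T)) \<partial>count_space \<Lambda>)"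
    using transversal_translates(1)[OF \<Lambda>(1) T(2)] sets.Int[OF B translate_in_borel[OF T(1)]] sets \<Lambda>(2)
    by (intro emeasure_UN_countable) (auto simp: disjoint_family_on_def)
  also have "\<dots> = (\<integral>\<^sup>+\<kappa>. emeasure (nu_part \<mu> T \<kappa>) ((- \<kappa>) +o B) \<partial>count_space \<Lambda>)"
  proof (rule nn_integral_cong)
    fix \<kappa>
    have "\<kappa> +o ((- \<kappa> +o B) \<inter> T) = B \<inter> (\<kappa> +o T)" by (auto simp: translate_eq_vimage)
    then show "emeasure \<mu> (B \<inter> (\<kappa> +o T)) = emeasure (nu_part \<mu> T \<kappa>) (- \<kappa> +o B)"
      using emeasure_nu_part_eq[OF sets T(1) translate_in_borel[OF B], of \<kappa> "- \<kappa>"] by simp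
  qed
  finally show ?thesis .
qed

text \<open>The measure \<open>\<mu>\<close> can be recovered from its pieces on the translates of \<open>T\<close>. If all of them are copies of one
  measure, then translation by an element of \<open>\<Lambda>\<close> permutes the pieces.\<close>

lemma invariant_iff_nu_parts_equal:
  fixes T :: "'a::{topological_ab_group_add, t2_space} set"
  assumes sets: "sets \<mu> = sets borel" and T: "T \<in> sets borel" "transversal \<Lambda> T"
    and \<Lambda>: "add_subgroup \<Lambda>" "countable \<Lambda>"
  shows "(\<forall>\<kappa>\<in>\<Lambda>. translated \<mu> \<kappa> = \<mu>) \<longleftrightarrow> (\<forall>\<kappa>\<in>\<Lambda>. nu_part \<mu> T \<kappa> = nu_part \<mu> T 0)"
proof
  assume inv: "\<forall>\<kappa>\<in>\<Lambda>. translated \<mu> \<kappa> = \<mu>"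
  show "\<forall>\<kappa>\<in>\<Lambda>. nu_part \<mu> T \<kappa> = nu_part \<mu> T 0"
  proof
    fix \<kappa> assume \<kappa>: "\<kappa> \<in> \<Lambda>"
    show "nu_part \<mu> T \<kappa> = nu_part \<mu> T 0"
    proof (rule measure_eqI)
      fix B assume "B \<in> sets (nu_part \<mu> T \<kappa>)"
      then have B: "B \<in> sets borel" by simp
      then have BT: "B \<inter> T \<in> sets borel" using T(1) by auto
      have "emeasure (nu_part \<mu> T \<kappa>) B = emeasure (translated \<mu> \<kappa>) (B \<inter> T)"
        unfolding emeasure_nu_part_eq[OF sets T(1) B] emeasure_translated[OF sets BT] ..
      also have "\<dots> = emeasure \<mu> (B \<inter> T)" using inv \<kappa> by simp
      also have "\<dots> = emeasure (nu_part \<mu> T 0) B"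
        unfolding emeasure_nu_part_eq[OF sets T(1) B] by (simp add: translate_eq_vimage)
      finally show "emeasure (nu_part \<mu> T \<kappa>) B = emeasure (nu_part \<mu> T 0) B" .
    qed simp
  qed
next
  assume eq: "\<forall>\<kappa>\<in>\<Lambda>. nu_part \<mu> T \<kappa> = nu_part \<mu> T 0"
  define \<rho> where "\<rho> = nu_part \<mu> T 0"
  have decomp: "emeasure \<mu> B = (\<integral>\<^sup>+\<kappa>. emeasure \<rho> ((- \<kappa>) +o B) \<partial>count_space \<Lambda>)"
    if "B \<in> sets borel" for B
    unfolding emeasure_decompose_translates[OF sets T \<Lambda> that] \<rho>_def
    by (rule nn_integral_cong) (use eq in auto)
  show "\<forall>\<kappa>\<in>\<Lambda>. translated \<mu> \<kappa> = \<mu>"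
  proof
    fix \<theta> assume \<theta>: "\<theta> \<in> \<Lambda>"
    have bij: "bij_betw (\<lambda>\<kappa>. \<kappa> + \<theta>) \<Lambda> \<Lambda>"
    proof (rule bij_betw_byWitness[of _ "\<lambda>\<kappa>. \<kappa> - \<theta>"])
      show "(\<lambda>\<kappa>. \<kappa> + \<theta>) ` \<Lambda> \<subseteq> \<Lambda>" "(\<lambda>\<kappa>. \<kappa> - \<theta>) ` \<Lambda> \<subseteq> \<Lambda>"
        using \<Lambda>(1) \<theta> unfolding add_subgroup_def by (metis diff_conv_add_uminus image_subsetI)+
    qed auto
    show "translated \<mu> \<theta> = \<mu>"
    proof (rule measure_eqI)
      show "sets (translated \<mu> \<theta>) = sets \<mu>" using sets by simp
      fix B assume "B \<in> sets (translated \<mu> \<theta>)"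
      then have B: "B \<in> sets borel" by simp
      have "emeasure (translated \<mu> \<theta>) B = (\<integral>\<^sup>+\<kappa>. emeasure \<rho> ((- \<kappa>) +o (\<theta> +o B)) \<partial>count_space \<Lambda>)"
        unfolding emeasure_translated[OF sets B] by (rule decomp[OF translate_in_borel[OF B]])
      also have "\<dots> = (\<integral>\<^sup>+\<kappa>. emeasure \<rho> ((- (\<kappa> + \<theta>)) +o (\<theta> +o B)) \<partial>count_space \<Lambda>)"
        by (rule nn_integral_bij_count_space[OF bij, symmetric])
      also have "\<dots> = (\<integral>\<^sup>+\<kappa>. emeasure \<rho> ((- \<kappa>) +o B) \<partial>count_space \<Lambda>)"
        by (simp add: translate_eq_vimage vimage_def algebra_simps)
      also have "\<dots> = emeasure \<mu> B" by (rule decomp[OF B, symmetric])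
      finally show "emeasure (translated \<mu> \<theta>) B = emeasure \<mu> B" .
    qed
  qed
qed

lemma emeasure_nu_sum_UNIV:
  fixes T :: "'a::{topological_ab_group_add, t2_space} set"
  assumes sets: "sets \<mu> = sets borel" and T: "T \<in> sets borel" "transversal \<Lambda> T"
    and \<Lambda>: "add_subgroup \<Lambda>" "countable \<Lambda>"
  shows "emeasure (nu_sum \<mu> T \<Lambda>) UNIV = emeasure \<mu> UNIV"
  using emeasure_decompose_translates[OF assms, of UNIV]
  by (simp add: emeasure_nu_sum[OF \<Lambda>(2)] infsum_eq_nn_integral_count_space[OF \<Lambda>(2)] translate_eq_vimage)

text \<open>Equal summands of \<open>\<nu>\<close> are \<open>\<nu> / n\<close>, which has the constant density \<open>1 / n\<close>; densities with respect to a finite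
  measure are unique up to null sets.\<close>

lemma nu_parts_equal_iff_density_const:
  fixes T :: "'a::{topological_ab_group_add, t2_space} set"
  assumes \<mu>: "finite_measure \<mu>" "sets \<mu> = sets borel" and T: "T \<in> sets borel" "transversal \<Lambda> T"
    and \<Lambda>: "add_subgroup \<Lambda>" "finite \<Lambda>"
    and h: "\<And>\<kappa>. \<kappa> \<in> \<Lambda> \<Longrightarrow> RN_version_on T (nu_sum \<mu> T \<Lambda>) (nu_part \<mu> T \<kappa>) (h \<kappa>)"
  shows "(\<forall>\<kappa>\<in>\<Lambda>. nu_part \<mu> T \<kappa> = nu_part \<mu> T 0) \<longleftrightarrow>
      (\<forall>\<kappa>\<in>\<Lambda>. AE \<gamma> in nu_sum \<mu> T \<Lambda>. h \<kappa> \<gamma> = 1 / real (card \<Lambda>))"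
proof -
  interpret finite_measure \<mu> by fact
  define \<nu> where "\<nu> = nu_sum \<mu> T \<Lambda>"
  define r where "r = 1 / real (card \<Lambda>)"
  have zero: "0 \<in> \<Lambda>" using \<Lambda>(1) by (simp add: add_subgroup_def)
  have n: "0 < card \<Lambda>" using zero \<Lambda>(2) by (auto simp: card_gt_0_iff)
  have sets\<nu>: "sets \<nu> = sets borel" by (simp add: \<nu>_def)
  have space\<nu>: "space \<nu> = UNIV" using sets_eq_imp_space_eq[OF sets\<nu>] by simp
  have "emeasure \<nu> (space \<nu>) \<noteq> \<infinity>"
    unfolding space\<nu> using emeasure_nu_sum_UNIV[OF \<mu>(2) T \<Lambda>(1) countable_finite[OF \<Lambda>(2)]]
    by (simp add: \<nu>_def)
  then interpret \<nu>: finite_measure \<nu> by (rule finite_measureI)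
  have sum: "emeasure \<nu> B = (\<Sum>\<kappa>\<in>\<Lambda>. emeasure (nu_part \<mu> T \<kappa>) B)" if "B \<in> sets borel" for B
    unfolding \<nu>_def using emeasure_nu_sum[OF countable_finite[OF \<Lambda>(2)] that] \<Lambda>(2) by simp
  have meas: "(\<lambda>\<gamma>. ennreal (h \<kappa> \<gamma>)) \<in> borel_measurable \<nu>" if "\<kappa> \<in> \<Lambda>" for \<kappa>
  proof -
    have "h \<kappa> \<in> borel_measurable \<nu>"
      using h[OF that] by (simp add: RN_version_on_def measurable_cong_sets[OF sets\<nu> refl])
    then show ?thesis by simp
  qed
  have "(\<forall>\<kappa>\<in>\<Lambda>. nu_part \<mu> T \<kappa> = nu_part \<mu> T 0) \<longleftrightarrow> (\<forall>\<kappa>\<in>\<Lambda>. nu_part \<mu> T \<kappa> = density \<nu> (\<lambda>_. ennreal r))"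
  proof
    assume eq: "\<forall>\<kappa>\<in>\<Lambda>. nu_part \<mu> T \<kappa> = nu_part \<mu> T 0"
    show "\<forall>\<kappa>\<in>\<Lambda>. nu_part \<mu> T \<kappa> = density \<nu> (\<lambda>_. ennreal r)"
    proof
      fix \<kappa> assume \<kappa>: "\<kappa> \<in> \<Lambda>"
      show "nu_part \<mu> T \<kappa> = density \<nu> (\<lambda>_. ennreal r)"
      proof (rule measure_eqI)
        fix B assume "B \<in> sets (nu_part \<mu> T \<kappa>)"
        then have B: "B \<in> sets borel" by simp
        have "emeasure \<nu> B = (\<Sum>\<theta>\<in>\<Lambda>. emeasure (nu_part \<mu> T \<kappa>) B)"
          unfolding sum[OF B] using eq \<kappa> by (intro sum.cong refl) metis
        also have "\<dots> = ennreal (real (card \<Lambda>)) * emeasure (nu_part \<mu> T \<kappa>) B"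
          by (simp add: ennreal_of_nat_eq_real_of_nat)
        finally have "emeasure (density \<nu> (\<lambda>_. ennreal r)) B =
            ennreal r * (ennreal (real (card \<Lambda>)) * emeasure (nu_part \<mu> T \<kappa>) B)"
          using B by (simp add: emeasure_density_const sets\<nu>)
        also have "\<dots> = ennreal (r * real (card \<Lambda>)) * emeasure (nu_part \<mu> T \<kappa>) B"
          by (subst ennreal_mult) (auto simp: r_def mult.assoc)
        also have "\<dots> = emeasure (nu_part \<mu> T \<kappa>) B" using n by (simp add: r_def)
        finally show "emeasure (nu_part \<mu> T \<kappa>) B = emeasure (density \<nu> (\<lambda>_. ennreal r)) B" by simp
      qed (simp add: sets\<nu>)
    qed
  qed (use zero in simp)
  also have "\<dots> \<longleftrightarrow> (\<forall>\<kappa>\<in>\<Lambda>. density \<nu> (\<lambda>\<gamma>. ennreal (h \<kappa> \<gamma>)) = density \<nu> (\<lambda>_. ennreal r))"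
    using h by (simp add: RN_version_on_def \<nu>_def)
  also have "\<dots> \<longleftrightarrow> (\<forall>\<kappa>\<in>\<Lambda>. AE \<gamma> in \<nu>. ennreal (h \<kappa> \<gamma>) = ennreal r)"
    using meas by (intro ball_cong refl \<nu>.density_unique_iff) auto
  also have "\<dots> \<longleftrightarrow> (\<forall>\<kappa>\<in>\<Lambda>. AE \<gamma> in \<nu>. h \<kappa> \<gamma> = r)"
    using h by (intro ball_cong refl) (simp add: RN_version_on_def r_def)
  finally show ?thesis unfolding \<nu>_def r_def .
qed

lemma nu_parts_equal_infinite:
  fixes T :: "'a::{topological_ab_group_add, t2_space} set"
  assumes \<mu>: "finite_measure \<mu>" "sets \<mu> = sets borel" and T: "T \<in> sets borel" "transversal \<Lambda> T"
    and \<Lambda>: "add_subgroup \<Lambda>" "countable \<Lambda>" "infinite \<Lambda>"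
    and eq: "\<forall>\<kappa>\<in>\<Lambda>. nu_part \<mu> T \<kappa> = nu_part \<mu> T 0"
  shows "emeasure \<mu> UNIV = 0"
proof -
  interpret finite_measure \<mu> by fact
  have "emeasure \<mu> UNIV = (\<integral>\<^sup>+\<kappa>. emeasure (nu_part \<mu> T \<kappa>) UNIV \<partial>count_space \<Lambda>)"
    using emeasure_decompose_translates[OF \<mu>(2) T \<Lambda>(1,2), of UNIV] by (simp add: translate_eq_vimage)
  also have "\<dots> = (\<integral>\<^sup>+\<kappa>. emeasure (nu_part \<mu> T 0) UNIV \<partial>count_space \<Lambda>)"
    by (rule nn_integral_cong) (use eq in auto)
  also have "\<dots> = emeasure (nu_part \<mu> T 0) UNIV * \<infinity>"
    using \<Lambda>(3) by simp
  finally have *: "emeasure \<mu> UNIV = emeasure (nu_part \<mu> T 0) UNIV * \<infinity>" .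
  have "emeasure \<mu> UNIV \<noteq> \<infinity>" by simp
  then have "emeasure (nu_part \<mu> T 0) UNIV = 0"
    using * by (auto simp: ennreal_mult_eq_top_iff)
  then show ?thesis using * by simp
qed

section \<open>Orthogonality and the densities\<close>

theorem theorem2p4:
  fixes H :: "'g::{topological_ab_group_add, t2_space} set"
    and \<mu> :: "'g dual measure"
    and T :: "'g dual set"
    and h :: "'g dual \<Rightarrow> 'g dual \<Rightarrow> real"
  assumes "locally_compact_space (euclidean :: 'g topology)"
    and "add_subgroup H" and "closed H"
    and "countable (annihilator H)"
    and "finite_regular_borel \<mu>"
    and "T \<in> sets borel" and "transversal (annihilator H) T"
    and "\<And>\<kappa>. \<kappa> \<in> annihilator H \<Longrightarrow>
           RN_version_on T (nu_sum \<mu> T (annihilator H)) (nu_part \<mu> T \<kappa>) (h \<kappa>)"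
  shows "(\<forall>n. finite (annihilator H) \<and> card (annihilator H) = n \<longrightarrow>
            (pairwise_orthogonal_cosets \<mu> H \<longleftrightarrow>
              (\<forall>\<kappa>\<in>annihilator H. AE \<gamma> in nu_sum \<mu> T (annihilator H). h \<kappa> \<gamma> = 1 / real n))) \<and>
         (infinite (annihilator H) \<and> emeasure \<mu> UNIV \<noteq> 0 \<longrightarrow>
            \<not> pairwise_orthogonal_cosets \<mu> H)"
proof -
  note \<mu> = finite_regular_borelD[OF assms(5)]
  have "pairwise_orthogonal_cosets \<mu> H \<longleftrightarrow> (\<forall>\<kappa>\<in>annihilator H. translated \<mu> \<kappa> = \<mu>)"
    unfolding pairwise_orthogonal_iff_fourier_zero[OF \<mu>(1,2) assms(2)]
    by (rule annihilator_invariant_iff_fourier_zero[OF assms(1-3,5), symmetric])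
  also have "\<dots> \<longleftrightarrow> (\<forall>\<kappa>\<in>annihilator H. nu_part \<mu> T \<kappa> = nu_part \<mu> T 0)"
    by (rule invariant_iff_nu_parts_equal[OF \<mu>(2) assms(6,7) add_subgroup_annihilator assms(4)])
  finally have key: "pairwise_orthogonal_cosets \<mu> H \<longleftrightarrow>
      (\<forall>\<kappa>\<in>annihilator H. nu_part \<mu> T \<kappa> = nu_part \<mu> T 0)" .
  show ?thesis
  proof (intro conjI allI impI)
    fix n assume n: "finite (annihilator H) \<and> card (annihilator H) = n"
    show "pairwise_orthogonal_cosets \<mu> H \<longleftrightarrow>
        (\<forall>\<kappa>\<in>annihilator H. AE \<gamma> in nu_sum \<mu> T (annihilator H). h \<kappa> \<gamma> = 1 / real n)"
      unfolding key
      using nu_parts_equal_iff_density_const[OF \<mu>(1,2) assms(6,7) add_subgroup_annihilator _ assms(8)] n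
      by simp
  next
    assume "infinite (annihilator H) \<and> emeasure \<mu> UNIV \<noteq> 0"
    then show "\<not> pairwise_orthogonal_cosets \<mu> H"
      unfolding key
      using nu_parts_equal_infinite[OF \<mu>(1,2) assms(6,7) add_subgroup_annihilator assms(4)] by blast
  qed
qed

end
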